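(* Consider a binary erasure relay channel with orthogonal half-duplex links: the source-relay, source-destination and relay-destination links are binary erasure channels with erasure probabilities $\epsilon_{SR},\epsilon_{SD},\epsilon_{RD}$, with $\epsilon_{SR}<\epsilon_{SD}$ and $\epsilon_{RD}<1$, and capacities $C_{SR}=1-\epsilon_{SR}$, $C_{SD}=1-\epsilon_{SD}$, $C_{RD}=1-\epsilon_{RD}$. Then there exist positive integer degrees $(l_1^{(n)},l_2^{(n)},r^{(n)})_{n\ge 1}$ with $r^{(n)}\to\infty$ such that, writing $l_1,l_2,r$ for $l_1^{(n)},l_2^{(n)},r^{(n)}$: (1) the LDPC convolutional codes $\mathcal{C}_1=\{l_1,r,L,w\}$ achieve the capacity of the source-relay link, i.e. $$\lim_{n\to\infty}\lim_{w\to\infty}\lim_{L\to\infty}R(l_1,r,L,w)=1-\epsilon_{SR},\qquad \lim_{n\to\infty}\lim_{w\to\infty}\lim_{L\to\infty}\epsilon^{BP}(l_1,r,L,w)=\epsilon_{SR};$$ (2) simultaneously, their bilayer extensions $\mathcal{C}=\{l_1,l_2,r,r,L,w\}$ achieve the capacity of the source-destination link, i.e. $$\lim_{n\to\infty}\lim_{w\to\infty}\lim_{L\to\infty}R(l_1,l_2,r,r,L,w)=1-\epsilon_{SD},\qquad \lim_{n\to\infty}\lim_{w\to\infty}\lim_{L\to\infty}\epsilon^{BP}(l_1,l_2,r,r,L,w)=\epsilon_{SD};$$ (3) the resulting relaying scheme (described in the context) provides the highest decode-and-forward rate: with $N_1$ and $N_2$ the numbers of channel uses in the first and second phase, $$\lim_{n\to\infty}\lim_{w\to\infty}\lim_{L\to\infty}\frac{N_1\,R(l_1,r,L,w)}{N_1+N_2}=R_{DF},$$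 where $$R_{DF}=\sup_{0\le\alpha\le1}\min\bigl(\alpha C_{SR},\ \alpha C_{SD}+(1-\alpha)C_{RD}\bigr).$$
   Context: **Single-layer ensemble $\{l,r,L,w\}$.** There are $M$ variable nodes of degree $l$ at each time $t=1,\dots,L$, and $Ml/r$ check nodes, each with $r$ edge sockets, at each time $1,\dots,L+w$. Each of the $l$ edges of a variable node at time $t$ is connected, uniformly and independently, to the check nodes at times in $\{t,\dots,t+w\}$. Correspondingly, each socket of a check node at time $s$ is attached to a uniformly and independently chosen time in $\{s-w,\dots,s\}$; sockets attached to times outside $\{1,\dots,L\}$ correspond to known (never erased) bits. The rate is the design rate (one minus the ratio of the numbers of check and variable nodes) $$R(l,r,L,w)=1-\frac{l}{r}\cdot\frac{L+w}{L}.$$ **Bilayer ensemble $\{l_1,l_2,r,r,L,w\}$.** The same $N=ML$ variable nodes are connected to two disjoint sets of check nodes (layers). Layer $a\in\{1,2\}$ is drawn from the ensemble $\{l_a,r,L,w\}$, and each check node is connected only to edges of its own layer. The rate is $$R(l_1,l_2,r,r,L,w)=1-\frac{l_1+l_2}{r}\cdot\frac{L+w}{L}.$$ **BP thresholds.** The BP threshold is taken in the limit $M\to\infty$ first. It is the supremum of $\epsilon\in[0,1]$ such that density evolution over a binary erasure channel with erasure probability $\epsilon$ drives all erasure probabilities to $0$ as the iteration number tends to infinity. - Single-layer: $x_t^{(0)}=\epsilon$ for $1\le t\le L$, $x_t^{(i)}=0$ for $t\notin\{1,\dots,L\}$, and for $1\le t\le L$ $$x_t^{(i+1)}=\epsilon\Bigl(\frac1{w+1}\sum_{j=0}^{w}\Bigl[1-\Bigl(1-\frac1{w+1}\sum_{k=0}^{w}x^{(i)}_{t+j-k}\Bigr)^{r-1}\Bigr]\Bigr)^{l-1}.$$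 The threshold is denoted $\epsilon^{BP}(l,r,L,w)$. - Bilayer: $x_{a,t}^{(i)}$ ($a=1,2$) is the variable-to-check erasure probability in layer $a$, with the same initial and boundary values. Put $$q_{a,t}^{(i)}=\frac1{w+1}\sum_{j=0}^{w}\Bigl[1-\Bigl(1-\frac1{w+1}\sum_{k=0}^{w}x^{(i)}_{a,t+j-k}\Bigr)^{r-1}\Bigr].$$ Then $x_{1,t}^{(i+1)}=\epsilon\,(q_{1,t}^{(i)})^{l_1-1}(q_{2,t}^{(i)})^{l_2}$ and $x_{2,t}^{(i+1)}=\epsilon\,(q_{1,t}^{(i)})^{l_1}(q_{2,t}^{(i)})^{l_2-1}$. The threshold is denoted $\epsilon^{BP}(l_1,l_2,r,r,L,w)$. **Relaying scheme.** In phase one, the source broadcasts a codeword of $\mathcal{C}_1=\{l_1,r,L,w\}$ with $N_1=N_V=ML$ channel uses, so $N_1R(l_1,r,L,w)$ information bits are conveyed; the relay decodes. In phase two, the source is silent and the relay forwards to the destination $N_{C2}=N_V(C_{SR}-C_{SD})$ syndrome bits, produced by the second-layer checks, using a capacity-achieving code of rate $C_{RD}$. This takes $N_2=N_{C2}/C_{RD}$ channel uses, and the syndrome bits are taken to be perfectly known at the destination. The destination decodes the bilayer code $\mathcal{C}=\{l_1,l_2,r,r,L,w\}$, where the first-layer checks equal zero and the second-layer checks equal the syndrome. $R_{DF}$ is the highest rate of decode-and-forward over this half-duplex relay channel with orthogonal links; $\alpha$ is the fraction of channel uses in the first phase.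
   Formalization: Part (3) is proved only when C_SD ≤ C_RD; when C_SD > C_RD it is false, since the scheme's rate tends to C_SR·C_RD/(C_RD+C_SR−C_SD), which is strictly less than R_DF = C_SD (e.g. capacities 1, 0.9, 0.1 give 0.5 versus 0.9). *)

theory Defs
  imports Complex_Main
begin

definition design_rate :: "nat \<Rightarrow> nat \<Rightarrow> nat \<Rightarrow> nat \<Rightarrow> real" where
  "design_rate l r L w = 1 - real l / real r * (real (L + w) / real L)"

definition bilayer_design_rate :: "nat \<Rightarrow> nat \<Rightarrow> nat \<Rightarrow> nat \<Rightarrow> nat \<Rightarrow> real" where
  "bilayer_design_rate l1 l2 r L w = 1 - real (l1 + l2) / real r * (real (L + w) / real L)"

text \<open>
  Erasure probabilities are indexed by integer times, so that the window can reach past both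
  ends of \<open>{1..L}\<close>; positions outside that range carry known bits (erasure probability 0).
  \<open>check_erasure\<close> is the average check-to-variable erasure probability seen at time \<open>t\<close>.
\<close>

definition check_erasure :: "nat \<Rightarrow> nat \<Rightarrow> (int \<Rightarrow> real) \<Rightarrow> int \<Rightarrow> real" where
  "check_erasure r w x t =
     1 / (real w + 1) *
       (\<Sum>j=0..w. 1 - (1 - 1 / (real w + 1) * (\<Sum>k=0..w. x (t + int j - int k))) ^ (r - 1))"

definition on_chain :: "nat \<Rightarrow> (int \<Rightarrow> real) \<Rightarrow> int \<Rightarrow> real" where
  "on_chain L x t = (if t \<in> {1..int L} then x t else 0)"

primrec density_evolution ::
  "nat \<Rightarrow> nat \<Rightarrow> nat \<Rightarrow> nat \<Rightarrow> real \<Rightarrow> nat \<Rightarrow> int \<Rightarrow> real" where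
  "density_evolution l r L w \<epsilon> 0 = on_chain L (\<lambda>t. \<epsilon>)"
| "density_evolution l r L w \<epsilon> (Suc i) =
     on_chain L (\<lambda>t. \<epsilon> * check_erasure r w (density_evolution l r L w \<epsilon> i) t ^ (l - 1))"

definition bp_threshold :: "nat \<Rightarrow> nat \<Rightarrow> nat \<Rightarrow> nat \<Rightarrow> real" where
  "bp_threshold l r L w =
     Sup {\<epsilon> \<in> {0..1}. \<forall>t \<in> {1..int L}.
            (\<lambda>i. density_evolution l r L w \<epsilon> i t) \<longlonglongrightarrow> 0}"

text \<open>The state is the pair of erasure profiles \<open>(x\<^sub>1, x\<^sub>2)\<close> of the two layers.\<close>

primrec bilayer_density_evolution ::
  "nat \<Rightarrow> nat \<Rightarrow> nat \<Rightarrow> nat \<Rightarrow> nat \<Rightarrow> real \<Rightarrow> nat \<Rightarrow> (int \<Rightarrow> real) \<times> (int \<Rightarrow> real)" where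
  "bilayer_density_evolution l1 l2 r L w \<epsilon> 0 = (on_chain L (\<lambda>t. \<epsilon>), on_chain L (\<lambda>t. \<epsilon>))"
| "bilayer_density_evolution l1 l2 r L w \<epsilon> (Suc i) =
     (let q1 = check_erasure r w (fst (bilayer_density_evolution l1 l2 r L w \<epsilon> i));
          q2 = check_erasure r w (snd (bilayer_density_evolution l1 l2 r L w \<epsilon> i))
      in (on_chain L (\<lambda>t. \<epsilon> * q1 t ^ (l1 - 1) * q2 t ^ l2),
          on_chain L (\<lambda>t. \<epsilon> * q1 t ^ l1 * q2 t ^ (l2 - 1))))"

definition bilayer_bp_threshold :: "nat \<Rightarrow> nat \<Rightarrow> nat \<Rightarrow> nat \<Rightarrow> nat \<Rightarrow> real" where
  "bilayer_bp_threshold l1 l2 r L w =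
     Sup {\<epsilon> \<in> {0..1}. \<forall>t \<in> {1..int L}.
            (\<lambda>i. fst (bilayer_density_evolution l1 l2 r L w \<epsilon> i) t) \<longlonglongrightarrow> 0 \<and>
            (\<lambda>i. snd (bilayer_density_evolution l1 l2 r L w \<epsilon> i) t) \<longlonglongrightarrow> 0}"

text \<open>
  \<open>C_SR\<close>, \<open>C_SD\<close>, \<open>C_RD\<close> are the capacities of the source-relay, source-destination and
  relay-destination links. In the second phase only the \<open>N_C2\<close> syndrome bits are sent, by the
  relay, at rate \<open>C_RD\<close>. The end-to-end rate is the number of information bits conveyed in the
  first phase per channel use of both phases.
\<close>

definition relay_scheme_rate ::
  "real \<Rightarrow> real \<Rightarrow> real \<Rightarrow> nat \<Rightarrow> nat \<Rightarrow> nat \<Rightarrow> nat \<Rightarrow> nat \<Rightarrow> real" where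
  "relay_scheme_rate C_SR C_SD C_RD M l1 r L w =
     (let N_V = real (M * L);
          N1 = N_V;
          N_C2 = N_V * (C_SR - C_SD);
          N2 = N_C2 / C_RD
      in N1 * design_rate l1 r L w / (N1 + N2))"

definition decode_forward_rate :: "real \<Rightarrow> real \<Rightarrow> real \<Rightarrow> real" where
  "decode_forward_rate C_SR C_SD C_RD =
     (SUP \<alpha>\<in>{0..1}. min (\<alpha> * C_SR) (\<alpha> * C_SD + (1 - \<alpha>) * C_RD))"

text \<open>
  \<open>iterated_lim f c\<close> is \<open>lim\<^sub>n lim\<^sub>w lim\<^sub>L f n w L = c\<close>, including the existence of all the
  inner limits.
\<close>

definition iterated_lim :: "(nat \<Rightarrow> nat \<Rightarrow> nat \<Rightarrow> real) \<Rightarrow> real \<Rightarrow> bool" where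
  "iterated_lim f c \<longleftrightarrow>
     (\<exists>g h. (\<forall>n w. (\<lambda>L. f n w L) \<longlonglongrightarrow> g n w) \<and> (\<forall>n. (\<lambda>w. g n w) \<longlonglongrightarrow> h n) \<and> h \<longlonglongrightarrow> c)"

end

theory Submission imports Defs begin

text \<open>
  Started from equal profiles, the two layers stay equal, so the bilayer recursion is the
  single-layer one with degree \<open>l\<^sub>1 + l\<^sub>2\<close> and only threshold saturation of the single-layer
  ensemble is needed.

  Put \<open>g z = 1 - (1 - z)^(r - 1)\<close> and \<open>P z = z * g z - \<integral>\<^sub>0\<^sup>z g\<close>. On a chain, let \<open>z\<close> be the profile
  of averaged erasure probabilities at the checks and \<open>u\<close> the average of \<open>g z\<close> seen by the
  variables. By convexity, density evolution decreases the potential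
  \<open>(\<Sum>s. P (z s)) - \<epsilon>/l * (\<Sum>t. u t ^ l)\<close>. If \<open>P z < \<epsilon>/l * g z ^ l\<close> for some \<open>z\<close>, then
  the flat profile \<open>z\<close> has negative potential on long chains, and decoding fails for every \<open>w\<close>.
  Conversely, the limiting profile \<open>x\<close> on the half-line \<open>t \<ge> 1\<close> is a nondecreasing fixed point
  with limit \<open>c\<close>; comparing it with its own shift by one position, the potential telescopes and
  convexity gives \<open>P c - \<epsilon>/l * g c ^ l \<le> 1/(w + 1)\<close>. As nonzero fixed points are bounded away
  from 0 when \<open>l \<ge> 3\<close>, this forces \<open>c = 0\<close> for large \<open>w\<close> as long as \<open>\<epsilon>\<close> is below
  \<open>inf l * P z / g z ^ l\<close>. So this infimum, capped at 1, is the limit of the thresholds, and it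
  approaches \<open>lim l/r\<close> as \<open>r\<close> grows.
\<close>

section \<open>Window averages and the check-node functions\<close>

definition window :: "nat \<Rightarrow> (int \<Rightarrow> real) \<Rightarrow> int \<Rightarrow> real" where
  "window w x s = 1 / (real w + 1) * (\<Sum>k=0..w. x (s - int k))"

definition dual_window :: "nat \<Rightarrow> (int \<Rightarrow> real) \<Rightarrow> int \<Rightarrow> real" where
  "dual_window w v t = 1 / (real w + 1) * (\<Sum>j=0..w. v (t + int j))"

definition check_map :: "nat \<Rightarrow> real \<Rightarrow> real" where
  "check_map r z = 1 - (1 - z) ^ (r - 1)"

text \<open>\<open>z * g z - \<integral>\<^sub>0\<^sup>z g\<close> for \<open>g = check_map r\<close>, that is, the convex conjugate of
  \<open>\<integral>\<^sub>0\<^sup>z g\<close> at \<open>g z\<close>.\<close>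

definition check_energy :: "nat \<Rightarrow> real \<Rightarrow> real" where
  "check_energy r z = (1 - (1 - z) ^ r) / real r - z * (1 - z) ^ (r - 1)"

lemma check_erasure_eq:
  "check_erasure r w x t = dual_window w (\<lambda>s. check_map r (window w x s)) t"
  by (simp add: check_erasure_def dual_window_def window_def check_map_def)

text \<open>This is the form in which convexity of powers enters every later estimate. Multiplying
  the induction hypothesis by \<open>b\<close> leaves a defect of
  \<open>n * a^(n-1) * (b - a)^2\<close>, which is nonnegative.\<close>

lemma power_ge_tangent:
  fixes a b :: real
  assumes "0 \<le> a" "0 \<le> b"
  shows "a ^ n + real n * a ^ (n - 1) * (b - a) \<le> b ^ n"
proof (induction n)
  case (Suc n)
  have "b * (a ^ n + real n * a ^ (n - 1) * (b - a)) \<le> b ^ Suc n"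
    using Suc assms by (simp add: mult_left_mono)
  moreover have "b * (a ^ n + real n * a ^ (n - 1) * (b - a)) - (a ^ Suc n + real (Suc n) * a ^ n * (b - a))
      = real n * a ^ (n - 1) * (b - a)\<^sup>2"
    by (cases n) (auto simp: algebra_simps power2_eq_square)
  moreover have "0 \<le> real n * a ^ (n - 1) * (b - a)\<^sup>2"
    using assms by simp
  ultimately show ?case by simp
qed simp

text \<open>As a function of \<open>v = check_map r z\<close>, the energy is a convex conjugate with
  slope \<open>z\<close> at \<open>v\<close>, so this is its subgradient inequality. It unfolds to
  the tangent inequality for the \<open>r\<close>-th power at \<open>1 - z'\<close>.\<close>

lemma check_energy_diff_le:
  assumes "0 < r" "z \<le> 1" "z' \<le> 1"
  shows "check_energy r z - check_energy r z' \<le> z * (check_map r z - check_map r z')"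
proof -
  have "(1 - z') ^ r + real r * (1 - z') ^ (r - 1) * (z' - z) \<le> (1 - z) ^ r"
    using power_ge_tangent[of "1 - z'" "1 - z" r] assms by simp
  then have "((1 - z') ^ r + real r * (1 - z') ^ (r - 1) * (z' - z)) / real r \<le> (1 - z) ^ r / real r"
    by (rule divide_right_mono) simp
  then show ?thesis
    using assms(1) by (simp add: check_energy_def check_map_def add_divide_distrib diff_divide_distrib algebra_simps)
qed

lemma check_map_mono: "z \<le> z' \<Longrightarrow> z' \<le> 1 \<Longrightarrow> check_map r z \<le> check_map r z'"
  unfolding check_map_def by (simp add: power_mono)

lemma check_map_bounds: "0 \<le> z \<Longrightarrow> z \<le> 1 \<Longrightarrow> 0 \<le> check_map r z \<and> check_map r z \<le> 1"
  unfolding check_map_def by (simp add: power_le_one)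

text \<open>Bernoulli's inequality. The linear bound near 0 is what later keeps nonzero fixed points
  away from 0.\<close>

lemma check_map_le: 
  assumes "0 \<le> z" "z \<le> 1"
  shows "check_map r z \<le> real r * z"
proof -
  have "1 + real (r - 1) * (- z) \<le> (1 - z) ^ (r - 1)"
    using power_ge_tangent[of 1 "1 - z" "r - 1"] assms by simp
  moreover have "real (r - 1) * z \<le> real r * z"
    using assms by (intro mult_right_mono) auto
  ultimately show ?thesis by (simp add: check_map_def)
qed

lemma window_mono: "(\<And>s. x s \<le> y s) \<Longrightarrow> window w x s \<le> window w y s"
  unfolding window_def by (intro mult_left_mono sum_mono) auto

lemma dual_window_mono: "(\<And>s. x s \<le> y s) \<Longrightarrow> dual_window w x s \<le> dual_window w y s"
  unfolding dual_window_def by (intro mult_left_mono sum_mono) auto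

lemma window_const [simp]: "window w (\<lambda>_. c) s = c"
  by (simp add: window_def field_simps)

lemma dual_window_const [simp]: "dual_window w (\<lambda>_. c) s = c"
  by (simp add: dual_window_def field_simps)

lemma window_bounds:
  assumes "\<And>s. 0 \<le> x s" "\<And>s. x s \<le> 1"
  shows "0 \<le> window w x s \<and> window w x s \<le> 1"
  using window_mono[of "\<lambda>_. 0" x w s] window_mono[of x "\<lambda>_. 1" w s] assms by simp

lemma dual_window_bounds:
  assumes "\<And>s. 0 \<le> x s" "\<And>s. x s \<le> 1"
  shows "0 \<le> dual_window w x s \<and> dual_window w x s \<le> 1"
  using dual_window_mono[of "\<lambda>_. 0" x w s] dual_window_mono[of x "\<lambda>_. 1" w s] assms by simp

lemma dual_window_diff: "dual_window w (\<lambda>s. a s - b s) t = dual_window w a t - dual_window w b t"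
  by (simp add: dual_window_def sum_subtractf algebra_simps diff_divide_distrib)

lemma check_erasure_bounds:
  assumes "\<And>s. 0 \<le> x s" "\<And>s. x s \<le> 1"
  shows "0 \<le> check_erasure r w x t \<and> check_erasure r w x t \<le> 1"
  unfolding check_erasure_eq
  by (intro dual_window_bounds) (use assms window_bounds check_map_bounds in blast)+

lemma check_erasure_mono:
  assumes "\<And>s. x s \<le> y s" "\<And>s. 0 \<le> y s" "\<And>s. y s \<le> 1"
  shows "check_erasure r w x t \<le> check_erasure r w y t"
  unfolding check_erasure_eq
  by (intro dual_window_mono check_map_mono window_mono) (use assms window_bounds in blast)+

lemma sum_shift:
  fixes x d :: "int \<Rightarrow> real"
  shows "(\<Sum>s\<in>{1..b}. x (s - k) * d s) = (\<Sum>t\<in>{1 - k..b - k}. x t * d (t + k))"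
  by (rule sum.reindex_bij_witness[of _ "\<lambda>t. t + k" "\<lambda>s. s - k"]) auto

lemma sum_window_expand:
  "(\<Sum>s\<in>A. window w x s * d s) = 1 / (real w + 1) * (\<Sum>k=0..w. \<Sum>s\<in>A. x (s - int k) * d s)"
proof -
  have "(\<Sum>s\<in>A. window w x s * d s) = (\<Sum>s\<in>A. \<Sum>k=0..w. 1 / (real w + 1) * (x (s - int k) * d s))"
    by (simp add: window_def sum_distrib_left sum_distrib_right mult_ac)
  then show ?thesis
    by (subst (asm) sum.swap) (simp add: sum_distrib_left)
qed

lemma sum_dual_window_expand:
  "(\<Sum>t\<in>A. x t * dual_window w d t) = 1 / (real w + 1) * (\<Sum>k=0..w. \<Sum>t\<in>A. x t * d (t + int k))"
proof -
  have "(\<Sum>t\<in>A. x t * dual_window w d t) = (\<Sum>t\<in>A. \<Sum>k=0..w. 1 / (real w + 1) * (x t * d (t + int k)))"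
    by (simp add: dual_window_def sum_distrib_left mult_ac)
  then show ?thesis
    by (subst (asm) sum.swap) (simp add: sum_distrib_left)
qed

text \<open>All shifts of the support of \<open>x\<close> by at most \<open>w\<close> stay inside
  \<open>{1..L+w}\<close>, so reindexing loses nothing and \<open>dual_window\<close> acts as the
  transpose of \<open>window\<close>.\<close>

lemma window_adjoint:
  assumes "\<And>t. t \<notin> {1..int L} \<Longrightarrow> x t = 0"
  shows "(\<Sum>s\<in>{1..int (L + w)}. window w x s * d s) = (\<Sum>t\<in>{1..int L}. x t * dual_window w d t)"
proof -
  have "(\<Sum>s\<in>{1..int (L + w)}. x (s - int k) * d s) = (\<Sum>t\<in>{1..int L}. x t * d (t + int k))"
    if "k \<in> {0..w}" for k
    unfolding sum_shift using that assms by (intro sum.mono_neutral_right) auto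
  then show ?thesis
    unfolding sum_window_expand sum_dual_window_expand by simp
qed

text \<open>On a truncated half-line the two sides differ by boundary terms, which are nonnegative.\<close>

lemma window_adjoint_le:
  assumes "\<And>t. t < 1 \<Longrightarrow> x t = 0" "\<And>t. 0 \<le> x t" "\<And>t. 0 \<le> d t"
  shows "(\<Sum>s\<in>{1..N}. window w x s * d s) \<le> (\<Sum>t\<in>{1..N}. x t * dual_window w d t)"
proof -
  have "(\<Sum>s\<in>{1..N}. x (s - int k) * d s) \<le> (\<Sum>t\<in>{1..N}. x t * d (t + int k))" for k
  proof -
    have "(\<Sum>t\<in>{1 - int k..N - int k}. x t * d (t + int k)) = (\<Sum>t\<in>{1..N - int k}. x t * d (t + int k))"
      using assms by (intro sum.mono_neutral_right) auto
    also have "\<dots> \<le> (\<Sum>t\<in>{1..N}. x t * d (t + int k))"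
      using assms by (intro sum_mono2) auto
    finally show ?thesis by (simp add: sum_shift)
  qed
  then show ?thesis
    unfolding sum_window_expand sum_dual_window_expand by (intro mult_left_mono sum_mono[of "{0..w}"]) auto
qed

lemma sum_telescope_int: "(\<Sum>t\<in>{1..int N}. \<phi> t - \<phi> (t - 1)) = \<phi> (int N) - (\<phi> 0 :: real)"
proof (induction N)
  case (Suc N)
  have "{1..int (Suc N)} = insert (int N + 1) {1..int N}" by auto
  with Suc show ?case by (simp add: algebra_simps)
qed simp

text \<open>The average telescopes to two end terms. For \<open>v\<close> with values in
  \<open>[0,1]\<close> it is therefore at most \<open>1/(w+1)\<close>, the error term of the
  saturation argument.\<close>

lemma dual_window_difference:
  "dual_window w (\<lambda>s. v s - v (s - 1)) t = (v (t + int w) - v (t - 1)) / (real w + 1)"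
proof -
  have "(\<Sum>j=0..w. v (t + int j) - v (t + int j - 1)) = v (t + int w) - v (t - 1)"
    by (induction w) (auto simp: algebra_simps)
  then show ?thesis by (simp add: dual_window_def)
qed

section \<open>Density evolution on a set of positions\<close>

definition erasure_step ::
  "int set \<Rightarrow> nat \<Rightarrow> nat \<Rightarrow> nat \<Rightarrow> real \<Rightarrow> (int \<Rightarrow> real) \<Rightarrow> int \<Rightarrow> real" where
  "erasure_step D l r w \<epsilon> x t = (if t \<in> D then \<epsilon> * check_erasure r w x t ^ (l - 1) else 0)"

text \<open>The set \<open>D\<close> of unknown positions is a parameter, so that finite chains
  \<open>{1..int L}\<close> and the half-line \<open>{1..}\<close> are iterates of one operator and
  can be compared by inclusion of their sets.\<close>

definition chain_evolution ::
  "int set \<Rightarrow> nat \<Rightarrow> nat \<Rightarrow> nat \<Rightarrow> real \<Rightarrow> nat \<Rightarrow> int \<Rightarrow> real" where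
  "chain_evolution D l r w \<epsilon> i = (erasure_step D l r w \<epsilon> ^^ i) (\<lambda>t. if t \<in> D then \<epsilon> else 0)"

lemma chain_evolution_0: "chain_evolution D l r w \<epsilon> 0 t = (if t \<in> D then \<epsilon> else 0)"
  by (simp add: chain_evolution_def)

lemma chain_evolution_Suc:
  "chain_evolution D l r w \<epsilon> (Suc i) = erasure_step D l r w \<epsilon> (chain_evolution D l r w \<epsilon> i)"
  by (simp add: chain_evolution_def)

lemma density_evolution_eq:
  "density_evolution l r L w \<epsilon> i = chain_evolution {1..int L} l r w \<epsilon> i"
proof (induction i)
  case 0
  show ?case by (auto simp: chain_evolution_0 on_chain_def)
next
  case (Suc i)
  then show ?case by (auto simp: chain_evolution_Suc on_chain_def erasure_step_def)
qed

lemma bilayer_density_evolution_eq: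
  assumes "0 < l1" "0 < l2"
  shows "bilayer_density_evolution l1 l2 r L w \<epsilon> i =
    (density_evolution (l1 + l2) r L w \<epsilon> i, density_evolution (l1 + l2) r L w \<epsilon> i)"
proof (induction i)
  case (Suc i)
  have "l1 - 1 + l2 = l1 + l2 - 1" "l1 + (l2 - 1) = l1 + l2 - 1" using assms by auto
  then show ?case
    by (simp add: Suc Let_def mult.assoc flip: power_add)
qed simp

lemma bilayer_bp_threshold_eq:
  "0 < l1 \<Longrightarrow> 0 < l2 \<Longrightarrow> bilayer_bp_threshold l1 l2 r L w = bp_threshold (l1 + l2) r L w"
  by (simp add: bilayer_bp_threshold_def bp_threshold_def bilayer_density_evolution_eq)

lemma erasure_step_bounds:
  assumes "\<And>s. 0 \<le> x s" "\<And>s. x s \<le> 1" "0 \<le> \<epsilon>"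
  shows "0 \<le> erasure_step D l r w \<epsilon> x t \<and> erasure_step D l r w \<epsilon> x t \<le> \<epsilon>"
proof -
  have "0 \<le> check_erasure r w x t ^ (l - 1) \<and> check_erasure r w x t ^ (l - 1) \<le> 1"
    using check_erasure_bounds[OF assms(1,2)] by (simp add: power_le_one)
  then show ?thesis
    using assms(3) by (simp add: erasure_step_def mult_left_le)
qed

lemma erasure_step_mono:
  assumes "\<And>s. 0 \<le> x s" "\<And>s. x s \<le> y s" "\<And>s. y s \<le> 1" "0 \<le> \<epsilon>" "D \<subseteq> D'"
  shows "erasure_step D l r w \<epsilon> x t \<le> erasure_step D' l r w \<epsilon> y t"
proof -
  have y: "\<And>s. 0 \<le> y s" "\<And>s. x s \<le> 1" using assms order_trans by blast+
  have "0 \<le> check_erasure r w x t" "check_erasure r w x t \<le> check_erasure r w y t"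
    using check_erasure_bounds[OF assms(1) y(2)] check_erasure_mono[OF assms(2) y(1) assms(3)]
    by auto
  then show ?thesis
    using assms(4,5) by (auto simp: erasure_step_def intro!: mult_left_mono power_mono)
qed

lemma chain_evolution_bounds:
  assumes "0 \<le> \<epsilon>" "\<epsilon> \<le> 1"
  shows "0 \<le> chain_evolution D l r w \<epsilon> i t \<and> chain_evolution D l r w \<epsilon> i t \<le> \<epsilon>"
proof (induction i arbitrary: t)
  case 0
  show ?case using assms by (simp add: chain_evolution_0)
next
  case (Suc i)
  show ?case unfolding chain_evolution_Suc
    by (rule erasure_step_bounds) (use Suc assms order_trans in blast)+
qed

lemma chain_evolution_le_1:
  "0 \<le> \<epsilon> \<Longrightarrow> \<epsilon> \<le> 1 \<Longrightarrow> chain_evolution D l r w \<epsilon> i t \<le> 1"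
  using chain_evolution_bounds order_trans by blast

lemma chain_evolution_mono:
  assumes "0 \<le> \<epsilon>" "\<epsilon> \<le> 1" "D \<subseteq> D'"
  shows "chain_evolution D l r w \<epsilon> i t \<le> chain_evolution D' l r w \<epsilon> i t"
proof (induction i arbitrary: t)
  case 0
  show ?case using assms by (auto simp: chain_evolution_0)
next
  case (Suc i)
  show ?case unfolding chain_evolution_Suc
    by (rule erasure_step_mono) (use Suc assms chain_evolution_bounds[OF assms(1,2)] order_trans in blast)+
qed

lemma chain_evolution_decreasing:
  assumes "0 \<le> \<epsilon>" "\<epsilon> \<le> 1"
  shows "chain_evolution D l r w \<epsilon> (Suc i) t \<le> chain_evolution D l r w \<epsilon> i t"
proof (induction i arbitrary: t)
  case 0
  have "\<And>s. 0 \<le> chain_evolution D l r w \<epsilon> 0 s" "\<And>s. chain_evolution D l r w \<epsilon> 0 s \<le> 1"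
    using assms by (simp_all add: chain_evolution_0)
  then have "erasure_step D l r w \<epsilon> (chain_evolution D l r w \<epsilon> 0) t \<le> \<epsilon>"
    by (intro conjunct2[OF erasure_step_bounds] assms(1))
  then show ?case
    unfolding chain_evolution_Suc by (cases "t \<in> D") (simp_all add: chain_evolution_0 erasure_step_def)
next
  case (Suc i)
  show ?case
    unfolding chain_evolution_Suc[of D l r w \<epsilon> "Suc i"]
    by (subst chain_evolution_Suc, rule erasure_step_mono)
      (use Suc assms chain_evolution_bounds[OF assms] order_trans in blast)+
qed

lemma check_erasure_shift: "check_erasure r w x (t + 1) = check_erasure r w (\<lambda>s. x (s + 1)) t"
  by (simp add: check_erasure_def algebra_simps)

text \<open>Moving the profile by one position turns the half-line \<open>{1..}\<close> into the
  larger set \<open>{0..}\<close>, and the step operator is monotone in the set and in the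
  profile.\<close>

lemma half_line_evolution_mono:
  assumes "0 \<le> \<epsilon>" "\<epsilon> \<le> 1"
  shows "chain_evolution {1..} l r w \<epsilon> i t \<le> chain_evolution {1..} l r w \<epsilon> i (t + 1)"
proof (induction i arbitrary: t)
  case 0
  show ?case using assms by (auto simp: chain_evolution_0)
next
  case (Suc i)
  let ?x = "chain_evolution {1..} l r w \<epsilon> i"
  have "erasure_step {1..} l r w \<epsilon> ?x t \<le> erasure_step {0..} l r w \<epsilon> (\<lambda>s. ?x (s + 1)) t"
    by (rule erasure_step_mono) (use Suc assms chain_evolution_bounds chain_evolution_le_1 in auto)
  also have "\<dots> = erasure_step {1..} l r w \<epsilon> ?x (t + 1)"
    by (simp add: erasure_step_def check_erasure_shift)
  finally show ?case by (simp add: chain_evolution_Suc)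
qed

section \<open>The potential and failure of decoding\<close>

definition chain_potential ::
  "nat \<Rightarrow> nat \<Rightarrow> nat \<Rightarrow> nat \<Rightarrow> real \<Rightarrow> (int \<Rightarrow> real) \<Rightarrow> real" where
  "chain_potential l r L w \<epsilon> z = (\<Sum>s\<in>{1..int (L + w)}. check_energy r (z s)) -
     (\<Sum>t\<in>{1..int L}. \<epsilon> / real l * dual_window w (\<lambda>s. check_map r (z s)) t ^ l)"

text \<open>The slope of the variable-node energy at \<open>u\<close> is
  \<open>\<epsilon> * u^(l-1)\<close>, exactly the density evolution update. This is how the
  recursion enters the potential estimates.\<close>

lemma node_energy_ge_tangent:
  fixes \<epsilon> u u' :: real
  assumes "0 \<le> \<epsilon>" "0 < l" "0 \<le> u" "0 \<le> u'"
  shows "\<epsilon> * u ^ (l - 1) * (u' - u) \<le> \<epsilon> / real l * u' ^ l - \<epsilon> / real l * u ^ l"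
proof -
  have "\<epsilon> / real l * (u ^ l + real l * u ^ (l - 1) * (u' - u)) \<le> \<epsilon> / real l * u' ^ l"
    using power_ge_tangent[of u u' l] assms by (intro mult_left_mono) auto
  moreover have "\<epsilon> / real l * (u ^ l + real l * u ^ (l - 1) * (u' - u))
      = \<epsilon> / real l * u ^ l + \<epsilon> * u ^ (l - 1) * (u' - u)"
    using assms(2) by (simp add: distrib_left)
  ultimately show ?thesis by linarith
qed

lemma chain_potential_descent:
  fixes z :: "int \<Rightarrow> real"
  assumes "0 < l" "0 < r" "0 \<le> \<epsilon>" "\<epsilon> \<le> 1" and z: "\<And>s. 0 \<le> z s" "\<And>s. z s \<le> 1"
    and x: "\<And>t. x t = (if t \<in> {1..int L} then \<epsilon> * dual_window w (\<lambda>s. check_map r (z s)) t ^ (l - 1) else 0)"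
  shows "chain_potential l r L w \<epsilon> (window w x) \<le> chain_potential l r L w \<epsilon> z"
proof -
  define v where "v s = check_map r (z s)" for s
  define v' where "v' s = check_map r (window w x s)" for s
  have v: "0 \<le> v s" "v s \<le> 1" for s using check_map_bounds z by (auto simp: v_def)
  have u: "0 \<le> dual_window w v t" "dual_window w v t \<le> 1" for t
    using dual_window_bounds[of v] v by blast+
  have x01: "0 \<le> x t" "x t \<le> 1" for t
    using assms(3,4) u[of t] power_le_one[OF u, of t "l - 1"]
    unfolding x v_def[symmetric] by (auto intro!: mult_le_one)
  have wx: "0 \<le> window w x s" "window w x s \<le> 1" for s using window_bounds[of x] x01 by blast+
  have v': "0 \<le> v' s" "v' s \<le> 1" for s using check_map_bounds wx by (auto simp: v'_def)
  have u': "0 \<le> dual_window w v' t" for t using dual_window_bounds[of v'] v' by blast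
  have "(\<Sum>s\<in>{1..int (L + w)}. check_energy r (window w x s) - check_energy r (z s))
      \<le> (\<Sum>s\<in>{1..int (L + w)}. window w x s * (v' s - v s))"
    unfolding v_def v'_def
    by (intro sum_mono check_energy_diff_le) (use assms(2) wx z in auto)
  also have "\<dots> = (\<Sum>t\<in>{1..int L}. x t * (dual_window w v' t - dual_window w v t))"
    by (subst window_adjoint) (auto simp: x dual_window_diff)
  also have "\<dots> \<le> (\<Sum>t\<in>{1..int L}. \<epsilon> / real l * dual_window w v' t ^ l - \<epsilon> / real l * dual_window w v t ^ l)"
    using node_energy_ge_tangent[OF assms(3,1) u(1) u']
    by (intro sum_mono) (simp add: x v_def[abs_def])
  finally show ?thesis
    by (simp add: chain_potential_def sum_subtractf v_def[abs_def] v'_def[abs_def])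
qed

lemma check_map_0 [simp]: "check_map r 0 = 0" and check_energy_0 [simp]: "check_energy r 0 = 0"
  by (simp_all add: check_map_def check_energy_def)

lemma tendsto_check_map:
  "(f \<longlongrightarrow> c) F \<Longrightarrow> ((\<lambda>i. check_map r (f i)) \<longlongrightarrow> check_map r c) F"
  unfolding check_map_def by (intro tendsto_intros)

lemma tendsto_check_energy:
  assumes "(f \<longlongrightarrow> c) F"
  shows "((\<lambda>i. check_energy r (f i)) \<longlongrightarrow> check_energy r c) F"
  unfolding check_energy_def divide_inverse by (intro tendsto_intros assms)

lemma tendsto_window:
  "(\<And>s. ((\<lambda>i. x i s) \<longlongrightarrow> y s) F) \<Longrightarrow> ((\<lambda>i. window w (x i) t) \<longlongrightarrow> window w y t) F"
  unfolding window_def by (intro tendsto_intros)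

lemma tendsto_dual_window:
  "(\<And>s. ((\<lambda>i. x i s) \<longlongrightarrow> y s) F) \<Longrightarrow> ((\<lambda>i. dual_window w (x i) t) \<longlongrightarrow> dual_window w y t) F"
  unfolding dual_window_def by (intro tendsto_intros)

text \<open>\<open>neg\<close> says that the flat profile \<open>x0\<close> has negative potential.
  Iterates started from it keep a potential bounded above by a negative number, whereas convergence
  to 0 would send the potential to 0.\<close>

lemma chain_evolution_not_to_zero:
  assumes "0 < l" "0 < r" "0 \<le> \<epsilon>" "\<epsilon> \<le> 1" "0 \<le> x0" "x0 \<le> 1"
    and neg: "real (L + w) * check_energy r x0 < real L * (\<epsilon> / real l * check_map r x0 ^ l)"
  shows "\<not> (\<forall>t\<in>{1..int L}. (\<lambda>i. chain_evolution {1..int L} l r w \<epsilon> i t) \<longlonglongrightarrow> 0)"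
proof
  assume lim: "\<forall>t\<in>{1..int L}. (\<lambda>i. chain_evolution {1..int L} l r w \<epsilon> i t) \<longlonglongrightarrow> 0"
  \<comment> \<open>The start is the variables' response to the flat check profile
    \<open>x0\<close>. It lies below the true initial profile \<open>\<epsilon>\<close>, so
    \<open>y\<close> stays below the true evolution.\<close>
  define y where "y i = (erasure_step {1..int L} l r w \<epsilon> ^^ i)
    (\<lambda>t. if t \<in> {1..int L} then \<epsilon> * check_map r x0 ^ (l - 1) else 0)" for i
  have c: "0 \<le> check_map r x0 ^ (l - 1)" "check_map r x0 ^ (l - 1) \<le> 1"
    using check_map_bounds[OF assms(5,6)] by (auto simp: power_le_one)
  have y_le: "0 \<le> y i t \<and> y i t \<le> chain_evolution {1..int L} l r w \<epsilon> i t" for i t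
  proof (induction i arbitrary: t)
    case 0
    show ?case using c assms by (auto simp: y_def chain_evolution_0 mult_left_le)
  next
    case (Suc i)
    have y1: "y i s \<le> 1" for s
      using Suc[of s] chain_evolution_le_1[OF assms(3,4), of "{1..int L}" l r w i s] by linarith
    have "0 \<le> erasure_step {1..int L} l r w \<epsilon> (y i) t"
      using erasure_step_bounds[of "y i" \<epsilon>] Suc y1 assms(3) by blast
    moreover have "erasure_step {1..int L} l r w \<epsilon> (y i) t
        \<le> erasure_step {1..int L} l r w \<epsilon> (chain_evolution {1..int L} l r w \<epsilon> i) t"
      by (rule erasure_step_mono) (use Suc assms chain_evolution_le_1 in auto)
    ultimately show ?case unfolding chain_evolution_Suc by (simp add: y_def)
  qed
  have y1: "y i s \<le> 1" for i s
    using y_le[of i s] chain_evolution_le_1[OF assms(3,4), of "{1..int L}" l r w i s] by linarith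
  have wy: "0 \<le> window w (y i) s" "window w (y i) s \<le> 1" for i s
    using window_bounds[of "y i"] y_le y1 by blast+
  define e where "e i = chain_potential l r L w \<epsilon> (window w (y i))" for i
  have e0: "e 0 < 0"
  proof -
    have "e 0 \<le> chain_potential l r L w \<epsilon> (\<lambda>_. x0)"
      unfolding e_def by (rule chain_potential_descent) (use assms in \<open>auto simp: y_def\<close>)
    also have "\<dots> < 0" using neg by (simp add: chain_potential_def)
    finally show ?thesis .
  qed
  have "e (Suc i) \<le> e i" for i
    unfolding e_def
    by (rule chain_potential_descent) 
      (use assms wy in \<open>auto simp: y_def erasure_step_def check_erasure_eq\<close>)
  then have e_le: "e i \<le> e 0" for i by (induction i) (use order_trans in blast)+
  have "(\<lambda>i. y i t) \<longlonglongrightarrow> 0" for t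
  proof (cases "t \<in> {1..int L}")
    case True
    then show ?thesis using lim y_le
      by (intro tendsto_sandwich[of "\<lambda>_. 0" "\<lambda>i. y i t" sequentially
            "\<lambda>i. chain_evolution {1..int L} l r w \<epsilon> i t"]) auto
  next
    case False
    then have "y i t = 0" for i by (cases i) (auto simp: y_def erasure_step_def)
    then show ?thesis by simp
  qed
  then have win: "(\<lambda>i. window w (y i) s) \<longlonglongrightarrow> 0" for s
    using tendsto_window[of y "\<lambda>_. 0"] by simp
  have "(\<lambda>i. dual_window w (\<lambda>s. check_map r (window w (y i) s)) t) \<longlonglongrightarrow> 0" for t
    using tendsto_dual_window[of "\<lambda>i s. check_map r (window w (y i) s)" "\<lambda>_. 0"] tendsto_check_map[OF win]
    by simp
  from tendsto_power[OF this, of _ l] 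
  have "e \<longlonglongrightarrow> (\<Sum>s\<in>{1..int (L + w)}. 0) - (\<Sum>t\<in>{1..int L}. \<epsilon> / real l * 0 ^ l)"
    unfolding e_def chain_potential_def
    by (intro tendsto_diff tendsto_sum tendsto_mult tendsto_const) (use tendsto_check_energy[OF win] in auto)
  then have "e \<longlonglongrightarrow> 0" using assms(1) by (simp add: power_0_left)
  then have "0 \<le> e 0" by (rule LIMSEQ_le_const2) (use e_le in auto)
  with e0 show False by simp
qed

section \<open>Fixed points on the half-line\<close>

lemma tendsto_int_shift:
  fixes f :: "int \<Rightarrow> real"
  assumes "(\<lambda>N. f (int N)) \<longlonglongrightarrow> c"
  shows "(\<lambda>N. f (int N + k)) \<longlonglongrightarrow> c"
proof (cases "0 \<le> k")
  case True
  then show ?thesis using LIMSEQ_ignore_initial_segment[OF assms, of "nat k"] by simp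
next
  case False
  show ?thesis
    by (rule LIMSEQ_offset[of _ "nat (- k)"]) (use False assms in simp)
qed

text \<open>Compare the profile with its shift by one: the energy differences telescope from
  position 0, where the window average vanishes, up to \<open>N\<close>. Convexity and transposition
  bound their sum by \<open>x\<close> paired with increments of \<open>u\<close>; then
  \<open>N\<close> tends to infinity. The second claim is the limit of the fixed-point equation
  itself.\<close>

lemma half_line_fixed_point_energy:
  fixes x :: "int \<Rightarrow> real"
  assumes "0 < l" "0 < r" "0 \<le> \<epsilon>" and x: "\<And>t. 0 \<le> x t" "\<And>t. x t \<le> 1" "\<And>t. x t \<le> x (t + 1)"
    and fixp: "\<And>t. x t = erasure_step {1..} l r w \<epsilon> x t"
    and lim: "(\<lambda>N. x (int N)) \<longlonglongrightarrow> c"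
  shows "check_energy r c \<le> \<epsilon> / real l * check_map r c ^ l + 1 / (real w + 1)"
    and "c = \<epsilon> * check_map r c ^ (l - 1)"
proof -
  define v where "v s = check_map r (window w x s)" for s
  define u where "u = dual_window w v"
  have x0: "x t = 0" if "t < 1" for t using fixp[of t] that by (simp add: erasure_step_def)
  have xu: "x t = \<epsilon> * u t ^ (l - 1)" if "1 \<le> t" for t
    using fixp[of t] that by (simp add: erasure_step_def check_erasure_eq u_def v_def[abs_def])
  have wx: "0 \<le> window w x s" "window w x s \<le> 1" for s using window_bounds[of x] x by blast+
  have v: "0 \<le> v s" "v s \<le> 1" for s using check_map_bounds wx by (auto simp: v_def)
  have u: "0 \<le> u t" "u t \<le> 1" for t unfolding u_def using dual_window_bounds[of v] v by blast+
  have wx_mono: "window w x (s - 1) \<le> window w x s" for s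
    using window_mono[of "\<lambda>s. x (s - 1)" x w s] x(3)[of "_ - 1"]
    by (simp add: window_def algebra_simps)
  then have v_mono: "v (s - 1) \<le> v s" for s unfolding v_def using wx check_map_mono by blast
  have x_lim: "(\<lambda>N. x (int N + k)) \<longlonglongrightarrow> c" for k
    using lim by (rule tendsto_int_shift)
  have v_lim: "(\<lambda>N. v (int N + k)) \<longlonglongrightarrow> check_map r c" for k
  proof -
    have "window w x (int N + k) = window w (\<lambda>s. x (int N + s)) k" for N
      by (simp add: window_def algebra_simps)
    moreover have "(\<lambda>N. window w (\<lambda>s. x (int N + s)) k) \<longlonglongrightarrow> window w (\<lambda>_. c) k"
      using x_lim by (rule tendsto_window)
    ultimately show ?thesis by (simp add: v_def tendsto_check_map)
  qed
  have u_lim: "(\<lambda>N. u (int N)) \<longlonglongrightarrow> check_map r c"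
    using tendsto_dual_window[of "\<lambda>N j. v (int N + j)" "\<lambda>_. check_map r c" sequentially w 0] v_lim
    by (simp add: u_def dual_window_def)
  have bound: "check_energy r (window w x (int N)) \<le> \<epsilon> / real l * u (int N) ^ l + 1 / (real w + 1)" for N
  proof -
    have "window w x 0 = 0" by (simp add: window_def x0)
    then have "check_energy r (window w x (int N)) =
        (\<Sum>s\<in>{1..int N}. check_energy r (window w x s) - check_energy r (window w x (s - 1)))"
      by (subst sum_telescope_int) simp
    also have "\<dots> \<le> (\<Sum>s\<in>{1..int N}. window w x s * (v s - v (s - 1)))"
      unfolding v_def by (intro sum_mono check_energy_diff_le) (use assms(2) wx in auto)
    also have "\<dots> \<le> (\<Sum>t\<in>{1..int N}. x t * dual_window w (\<lambda>s. v s - v (s - 1)) t)"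
      by (rule window_adjoint_le) (use x0 x v_mono in auto)
    \<comment> \<open>Tangency needs the slope at \<open>t - 1\<close>, so \<open>x t\<close> is
      replaced by \<open>x (t - 1)\<close>. The correction is small: the increments of
      \<open>x\<close> add up to at most 1, and each is weighted by at most
      \<open>1/(w+1)\<close>.\<close>
    also have "\<dots> = (\<Sum>t\<in>{1..int N}. x (t - 1) * dual_window w (\<lambda>s. v s - v (s - 1)) t)
       + (\<Sum>t\<in>{1..int N}. (x t - x (t - 1)) * dual_window w (\<lambda>s. v s - v (s - 1)) t)"
      by (simp add: algebra_simps flip: sum.distrib)
    also have "(\<Sum>t\<in>{1..int N}. (x t - x (t - 1)) * dual_window w (\<lambda>s. v s - v (s - 1)) t)
        \<le> (\<Sum>t\<in>{1..int N}. (x t - x (t - 1)) * (1 / (real w + 1)))"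
    proof (intro sum_mono mult_left_mono)
      show "dual_window w (\<lambda>s. v s - v (s - 1)) t \<le> 1 / (real w + 1)" for t
        unfolding dual_window_difference using v(1)[of "t - 1"] v(2)[of "t + int w"]
        by (intro divide_right_mono) auto
      show "0 \<le> x t - x (t - 1)" for t using x(3)[of "t - 1"] by simp
    qed
    also have "\<dots> = x (int N) * (1 / (real w + 1))"
      by (simp only: sum_distrib_right[symmetric] sum_telescope_int) (simp add: x0)
    also have "\<dots> \<le> 1 / (real w + 1)" using x by (simp add: divide_right_mono)
    also have "(\<Sum>t\<in>{1..int N}. x (t - 1) * dual_window w (\<lambda>s. v s - v (s - 1)) t)
        \<le> (\<Sum>t\<in>{1..int N}. \<epsilon> / real l * u t ^ l - \<epsilon> / real l * u (t - 1) ^ l)"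
    proof (intro sum_mono)
      fix t
      have "dual_window w (\<lambda>s. v s - v (s - 1)) t = u t - u (t - 1)"
        unfolding dual_window_diff by (simp add: u_def dual_window_def algebra_simps)
      moreover have "0 \<le> u t - u (t - 1)"
        unfolding calculation[symmetric]
        using dual_window_mono[of "\<lambda>_. 0" "\<lambda>s. v s - v (s - 1)"] v_mono by simp
      \<comment> \<open>Equality holds for \<open>t >= 2\<close>. At \<open>t = 1\<close> the left
        side is 0, because position 0 lies off the half-line; the inequality suffices as the
        increment of \<open>u\<close> is nonnegative.\<close>
      moreover have "x (t - 1) \<le> \<epsilon> * u (t - 1) ^ (l - 1)"
        using xu[of "t - 1"] x0[of "t - 1"] u(1)[of "t - 1"] assms(3) by (cases "1 \<le> t - 1") auto
      ultimately have "x (t - 1) * dual_window w (\<lambda>s. v s - v (s - 1)) t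
          \<le> \<epsilon> * u (t - 1) ^ (l - 1) * (u t - u (t - 1))"
        by (simp add: mult_right_mono)
      also have "\<dots> \<le> \<epsilon> / real l * u t ^ l - \<epsilon> / real l * u (t - 1) ^ l"
        by (rule node_energy_ge_tangent) (use assms u in auto)
      finally show "x (t - 1) * dual_window w (\<lambda>s. v s - v (s - 1)) t
          \<le> \<epsilon> / real l * u t ^ l - \<epsilon> / real l * u (t - 1) ^ l" .
    qed
    also have "\<dots> = \<epsilon> / real l * u (int N) ^ l - \<epsilon> / real l * u 0 ^ l"
      by (rule sum_telescope_int)
    also have "\<dots> \<le> \<epsilon> / real l * u (int N) ^ l" using assms u by simp
    finally show ?thesis by simp
  qed
  show "check_energy r c \<le> \<epsilon> / real l * check_map r c ^ l + 1 / (real w + 1)"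
  proof (rule LIMSEQ_le)
    have "(\<lambda>N. window w x (int N)) \<longlonglongrightarrow> c"
      using tendsto_window[of "\<lambda>N s. x (int N + s)" "\<lambda>_. c" sequentially w 0] x_lim
      by (simp add: window_def)
    then show "(\<lambda>N. check_energy r (window w x (int N))) \<longlonglongrightarrow> check_energy r c"
      by (rule tendsto_check_energy)
    show "(\<lambda>N. \<epsilon> / real l * u (int N) ^ l + 1 / (real w + 1)) \<longlonglongrightarrow>
        \<epsilon> / real l * check_map r c ^ l + 1 / (real w + 1)"
      by (intro tendsto_intros u_lim)
  qed (use bound in blast)
  have "(\<lambda>N. \<epsilon> * u (int N) ^ (l - 1)) \<longlonglongrightarrow> \<epsilon> * check_map r c ^ (l - 1)"
    by (intro tendsto_intros u_lim)
  moreover have "\<forall>\<^sub>F N in sequentially. \<epsilon> * u (int N) ^ (l - 1) = x (int N)"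
    using eventually_ge_at_top[of 1] by eventually_elim (simp add: xu)
  ultimately have "(\<lambda>N. x (int N)) \<longlonglongrightarrow> \<epsilon> * check_map r c ^ (l - 1)"
    by (rule Lim_transform_eventually)
  with lim show "c = \<epsilon> * check_map r c ^ (l - 1)" by (rule LIMSEQ_unique)
qed

section \<open>The potential threshold and decoding below it\<close>

text \<open>For \<open>r >= 2\<close> and \<open>l > 0\<close> this is the largest
  \<open>\<epsilon>\<close> in \<open>[0,1]\<close> with
  \<open>\<epsilon>/l * check_map r z ^ l <= check_energy r z\<close> on all of
  \<open>[0,1]\<close>. The point \<open>z = 0\<close> must be left out: the ratio there evaluates
  to 0 and would make the infimum 0.\<close>

definition potential_threshold :: "nat \<Rightarrow> nat \<Rightarrow> real" where
  "potential_threshold l r =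
     Inf (insert 1 ((\<lambda>z. real l * check_energy r z / check_map r z ^ l) ` {0<..1}))"

lemma check_energy_nonneg:
  assumes "0 < r" "0 \<le> z" "z \<le> 1"
  shows "0 \<le> check_energy r z"
  using check_energy_diff_le[of r 0 z] assms by simp

lemma check_map_pos: 
  assumes "2 \<le> r" "0 < z" "z \<le> 1"
  shows "0 < check_map r z"
proof -
  have "(1 - z) ^ (r - 1) < 1" using assms by (intro power_less_one_iff[THEN iffD2]) auto
  then show ?thesis by (simp add: check_map_def)
qed

lemma potential_ratio_nonneg:
  assumes "2 \<le> r"
  shows "y \<in> insert 1 ((\<lambda>z. real l * check_energy r z / check_map r z ^ l) ` {0<..1}) \<Longrightarrow> 0 \<le> y"
  using assms check_energy_nonneg[of r] check_map_bounds[of _ r] by (auto simp: less_imp_le)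

lemma bdd_below_potential:
  "2 \<le> r \<Longrightarrow> bdd_below (insert 1 ((\<lambda>z. real l * check_energy r z / check_map r z ^ l) ` {0<..1}))"
  using potential_ratio_nonneg by (intro bdd_belowI[of _ 0]) blast

lemma potential_threshold_bounds:
  assumes "2 \<le> r"
  shows "0 \<le> potential_threshold l r" "potential_threshold l r \<le> 1"
proof -
  show "0 \<le> potential_threshold l r" unfolding potential_threshold_def
    by (rule cInf_greatest) (use potential_ratio_nonneg[OF assms] in auto)
  show "potential_threshold l r \<le> 1" unfolding potential_threshold_def
    by (rule cInf_lower) (use bdd_below_potential[OF assms] in auto)
qed

lemma potential_threshold_le:
  assumes "2 \<le> r" "0 < z" "z \<le> 1"
  shows "potential_threshold l r \<le> real l * check_energy r z / check_map r z ^ l"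
  unfolding potential_threshold_def by (rule cInf_lower) (use assms bdd_below_potential[OF assms(1)] in auto)

text \<open>The decreasing iterates converge to a monotone fixed point with limit \<open>c\<close>
  at infinity. If \<open>c\<close> were nonzero, its scalar potential would be at least
  \<open>\<gamma>\<close>, against the bound \<open>1/(w+1)\<close>.\<close>

lemma chain_evolution_half_line_to_zero:
  assumes l: "3 \<le> l" and r: "2 \<le> r" and \<epsilon>: "0 \<le> \<epsilon>" "\<epsilon> < potential_threshold l r"
  obtains w0 where "\<And>w t. w0 \<le> w \<Longrightarrow> (\<lambda>i. chain_evolution {1..} l r w \<epsilon> i t) \<longlonglongrightarrow> 0"
proof -
  have \<epsilon>1: "\<epsilon> \<le> 1" using \<epsilon> potential_threshold_bounds[OF r, of l] by linarith
  \<comment> \<open>A nonzero \<open>c\<close> satisfies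
    \<open>c <= (r * c)^(l-1) <= r^(l-1) * c^2\<close>, where the last step uses
    \<open>l >= 3\<close> and \<open>c <= 1\<close>. Hence \<open>c >= \<delta>\<close>, uniformly
    in \<open>w\<close>.\<close>
  define \<delta> where "\<delta> = 1 / real r ^ (l - 1)"
  have \<delta>: "0 < \<delta>" "\<delta> \<le> 1" using r by (auto simp: \<delta>_def)
  \<comment> \<open>A lower bound, independent of \<open>w\<close>, for the scalar potential at
    every point of \<open>[\<delta>, 1]\<close>.\<close>
  define \<gamma> where "\<gamma> = (potential_threshold l r - \<epsilon>) / real l * check_map r \<delta> ^ l"
  have \<gamma>: "0 < \<gamma>" using \<epsilon> l check_map_pos[OF r \<delta>] by (simp add: \<gamma>_def)
  obtain w0 :: nat where w0: "1 / \<gamma> < real w0" using reals_Archimedean2 by blast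
  show thesis
  proof (rule that)
    fix w t assume "w0 \<le> w"
    have "1 < \<gamma> * real w0" using w0 \<gamma> by (simp add: field_simps)
    also have "\<dots> \<le> \<gamma> * (real w + 1)" using \<gamma> \<open>w0 \<le> w\<close> by simp
    finally have w: "1 / (real w + 1) < \<gamma>" by (simp add: field_simps)
    define X where "X = chain_evolution {1..} l r w \<epsilon>"
    note X = chain_evolution_bounds[OF \<epsilon>(1) \<epsilon>1, of "{1..}" l r w, folded X_def]
      chain_evolution_le_1[OF \<epsilon>(1) \<epsilon>1, of "{1..}" l r w, folded X_def]
    define x where "x t = lim (\<lambda>i. X i t)" for t
    have X_lim: "(\<lambda>i. X i t) \<longlonglongrightarrow> x t" for t
    proof -
      have "decseq (\<lambda>i. X i t)"
        using chain_evolution_decreasing[OF \<epsilon>(1) \<epsilon>1] by (intro decseq_SucI) (simp add: X_def)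
      then have "convergent (\<lambda>i. X i t)"
        using decseq_convergent[of "\<lambda>i. X i t" 0] X by (metis convergentI)
      then show ?thesis by (simp add: x_def convergent_LIMSEQ_iff)
    qed
    have x: "0 \<le> x t" "x t \<le> 1" "x t \<le> x (t + 1)" for t
    proof -
      show "0 \<le> x t" using X_lim by (rule LIMSEQ_le_const) (use X in auto)
      show "x t \<le> 1" using X_lim by (rule LIMSEQ_le_const2) (use X in auto)
      show "x t \<le> x (t + 1)" using X_lim X_lim
        by (rule LIMSEQ_le) (use half_line_evolution_mono[OF \<epsilon>(1) \<epsilon>1] in \<open>auto simp: X_def\<close>)
    qed
    have "(\<lambda>i. check_erasure r w (X i) t) \<longlonglongrightarrow> check_erasure r w x t" for t
      unfolding check_erasure_eq by (intro tendsto_dual_window tendsto_check_map tendsto_window X_lim)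
    then have "(\<lambda>i. erasure_step {1..} l r w \<epsilon> (X i) t) \<longlonglongrightarrow> erasure_step {1..} l r w \<epsilon> x t" for t
      by (cases "t \<in> {1..}") (auto simp: erasure_step_def intro!: tendsto_intros)
    moreover have "(\<lambda>i. erasure_step {1..} l r w \<epsilon> (X i) t) \<longlonglongrightarrow> x t" for t
      using LIMSEQ_Suc[OF X_lim[of t]] by (simp add: X_def chain_evolution_Suc)
    ultimately have fixp: "x t = erasure_step {1..} l r w \<epsilon> x t" for t
      using LIMSEQ_unique by blast
    have inc: "incseq (\<lambda>N. x (int N))" using x(3) by (intro incseq_SucI) (metis of_nat_Suc add.commute)
    then obtain c where c: "(\<lambda>N. x (int N)) \<longlonglongrightarrow> c" and xc: "\<And>N. x (int N) \<le> c"
      using incseq_convergent[of "\<lambda>N. x (int N)" 1] x(2) by metis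
    have c01: "0 \<le> c" "c \<le> 1"
      using xc[of 0] x(1)[of 0] LIMSEQ_le_const2[OF c, of 1] x(2) by auto
    note energy = half_line_fixed_point_energy[OF _ _ \<epsilon>(1) x fixp c]
    have "c = 0"
    proof (rule ccontr)
      assume "c \<noteq> 0"
      then have c0: "0 < c" using c01 by simp
      have "c \<le> 1 * (real r * c) ^ (l - 1)"
        using energy(2) l r \<epsilon>(1) \<epsilon>1 check_map_bounds[OF c01] check_map_le[OF c01]
          mult_mono[of \<epsilon> 1 "check_map r c ^ (l - 1)" "(real r * c) ^ (l - 1)"]
        by (auto intro: power_mono)
      also have "\<dots> = real r ^ (l - 1) * c ^ (l - 3) * c * c"
        using l by (simp add: power_mult_distrib mult.assoc flip: power_Suc2 power_Suc)
          (simp add: numeral_3_eq_3 Suc_diff_Suc flip: power_Suc)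
      also have "\<dots> \<le> real r ^ (l - 1) * 1 * c * c"
        using c01 by (intro mult_mono) (auto intro: power_le_one)
      finally have "\<delta> \<le> c" using c0 r by (simp add: \<delta>_def field_simps)
      then have "check_map r \<delta> ^ l \<le> check_map r c ^ l"
        using check_map_mono[of \<delta> c r] check_map_bounds[of \<delta> r] \<delta> c01 by (intro power_mono) auto
      then have "\<gamma> \<le> (potential_threshold l r - \<epsilon>) / real l * check_map r c ^ l"
        unfolding \<gamma>_def using \<epsilon> by (intro mult_left_mono) auto
      also have "\<dots> \<le> check_energy r c - \<epsilon> / real l * check_map r c ^ l"
        using potential_threshold_le[OF r c0 c01(2), of l] check_map_pos[OF r c0 c01(2)] l
        by (simp add: field_simps)
      also have "\<dots> \<le> 1 / (real w + 1)" using energy(1) l r by simp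
      finally show False using w by simp
    qed
    have "x t = 0"
    proof (cases "1 \<le> t")
      case True
      then show ?thesis using xc[of "nat t"] x(1)[of t] \<open>c = 0\<close> by simp
    next
      case False
      then show ?thesis using fixp[of t] by (simp add: erasure_step_def)
    qed
    then show "(\<lambda>i. chain_evolution {1..} l r w \<epsilon> i t) \<longlonglongrightarrow> 0"
      using X_lim[of t] by (simp add: X_def)
  qed
qed

section \<open>BP thresholds and threshold saturation\<close>

lemma bp_threshold_eq:
  "bp_threshold l r L w = Sup {\<epsilon> \<in> {0..1}. \<forall>t \<in> {1..int L}.
     (\<lambda>i. chain_evolution {1..int L} l r w \<epsilon> i t) \<longlonglongrightarrow> 0}"
  by (simp add: bp_threshold_def density_evolution_eq)

text \<open>Makes the set under \<open>Sup\<close> nonempty, so that the least-upper-bound property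
  applies.\<close>

lemma zero_decodable:
  "(\<lambda>i. chain_evolution D l r w 0 i t) \<longlonglongrightarrow> 0"
proof -
  have "chain_evolution D l r w 0 i t = 0" for i
    using chain_evolution_bounds[of 0 D l r w i t] by simp
  then show ?thesis by simp
qed

lemma bp_threshold_ge:
  assumes "0 \<le> \<epsilon>" "\<epsilon> \<le> 1" "\<And>t. (\<lambda>i. chain_evolution {1..int L} l r w \<epsilon> i t) \<longlonglongrightarrow> 0"
  shows "\<epsilon> \<le> bp_threshold l r L w"
  unfolding bp_threshold_eq by (rule cSup_upper) (use assms in \<open>auto intro!: bdd_aboveI[of _ 1]\<close>)

lemma bp_threshold_le:
  assumes "\<And>\<epsilon>. 0 \<le> \<epsilon> \<Longrightarrow> \<epsilon> \<le> 1 \<Longrightarrow>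
    \<forall>t\<in>{1..int L}. (\<lambda>i. chain_evolution {1..int L} l r w \<epsilon> i t) \<longlonglongrightarrow> 0 \<Longrightarrow> \<epsilon> \<le> b"
  shows "bp_threshold l r L w \<le> b"
  unfolding bp_threshold_eq by (rule cSup_least) (use assms zero_decodable in \<open>auto intro!: exI[of _ 0]\<close>)

text \<open>A longer chain turns known bits into unknown ones, so whatever it decodes the shorter
  chain decodes too. This gives existence of the limit in \<open>L\<close>.\<close>

lemma bp_threshold_decseq: "decseq (\<lambda>L. bp_threshold l r L w)"
proof (rule decseq_SucI)
  fix L
  show "bp_threshold l r (Suc L) w \<le> bp_threshold l r L w"
  proof (rule bp_threshold_le)
    fix \<epsilon> :: real
    assume \<epsilon>: "0 \<le> \<epsilon>" "\<epsilon> \<le> 1"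
      and lim: "\<forall>t\<in>{1..int (Suc L)}. (\<lambda>i. chain_evolution {1..int (Suc L)} l r w \<epsilon> i t) \<longlonglongrightarrow> 0"
    have "(\<lambda>i. chain_evolution {1..int L} l r w \<epsilon> i t) \<longlonglongrightarrow> 0" for t
    proof (cases "t \<in> {1..int L}")
      case True
      then have t: "(\<lambda>i. chain_evolution {1..int (Suc L)} l r w \<epsilon> i t) \<longlonglongrightarrow> 0"
        by (intro bspec[OF lim]) auto
      show ?thesis
        by (rule tendsto_sandwich[OF _ _ tendsto_const t])
          (use chain_evolution_bounds[OF \<epsilon>] chain_evolution_mono[OF \<epsilon>, of "{1..int L}" "{1..int (Suc L)}"] in auto)
    next
      case False
      then have "chain_evolution {1..int L} l r w \<epsilon> i t = 0" for i
        by (cases i) (auto simp: chain_evolution_0 chain_evolution_Suc erasure_step_def)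
      then show ?thesis by simp
    qed
    with \<epsilon> show "\<epsilon> \<le> bp_threshold l r L w" by (rule bp_threshold_ge)
  qed
qed

lemma bp_threshold_bounds: "0 \<le> bp_threshold l r L w" "bp_threshold l r L w \<le> 1"
  by (rule bp_threshold_ge; simp add: zero_decodable) (rule bp_threshold_le)

lemma tendsto_chain_length_ratio: "(\<lambda>L. real (L + w) / real L) \<longlonglongrightarrow> 1"
proof -
  have "(\<lambda>L. 1 + real w / real L) \<longlonglongrightarrow> 1 + 0"
    by (intro tendsto_add tendsto_const lim_const_over_n)
  moreover have "\<forall>\<^sub>F L in sequentially. 1 + real w / real L = real (L + w) / real L"
    using eventually_gt_at_top[of 0] by eventually_elim (simp add: field_simps)
  ultimately show ?thesis by (simp add: Lim_transform_eventually)
qed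

text \<open>The upper bound holds for each fixed \<open>w\<close>, since the \<open>w\<close> extra
  check positions are negligible against \<open>L\<close>. The lower bound needs large
  \<open>w\<close> and comes from the half-line.\<close>

lemma threshold_saturation:
  assumes l: "3 \<le> l" and r: "2 \<le> r"
  obtains g where "\<And>w. (\<lambda>L. bp_threshold l r L w) \<longlonglongrightarrow> g w" "g \<longlonglongrightarrow> potential_threshold l r"
proof -
  define g where "g w = lim (\<lambda>L. bp_threshold l r L w)" for w
  have g: "(\<lambda>L. bp_threshold l r L w) \<longlonglongrightarrow> g w" for w
  proof -
    have "convergent (\<lambda>L. bp_threshold l r L w)"
      using decseq_convergent[OF bp_threshold_decseq] bp_threshold_bounds(1) by (metis convergentI)
    then show ?thesis by (simp add: g_def convergent_LIMSEQ_iff)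
  qed
  have upper: "g w \<le> potential_threshold l r" for w
  proof (rule dense_ge)
    fix \<eta> assume \<eta>: "potential_threshold l r < \<eta>"
    have \<eta>0: "0 \<le> \<eta>" using \<eta> potential_threshold_bounds[OF r, of l] by linarith
    show "g w \<le> \<eta>"
    proof (cases "1 \<le> \<eta>")
      case True
      then show ?thesis
        using LIMSEQ_le_const2[OF g, of w 1] bp_threshold_bounds by fastforce
    next
      case False
      \<comment> \<open>As \<open>\<eta> < 1\<close>, an element of the set below
        \<open>\<eta>\<close> cannot be the inserted 1, so it is a ratio at some
        \<open>z\<close>.\<close>
      then obtain z where z: "0 < z" "z \<le> 1" "real l * check_energy r z / check_map r z ^ l < \<eta>"
        using cInf_lessD[OF _ \<eta>[unfolded potential_threshold_def]] by auto
      define p where "p = check_map r z ^ l"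
      have p: "0 < p" using check_map_pos[OF r z(1,2)] by (simp add: p_def)
      have "check_energy r z < \<eta> / real l * p"
        using z(3) p l unfolding p_def[symmetric] by (simp add: field_simps)
      moreover have "(\<lambda>L. real (L + w) / real L * check_energy r z) \<longlonglongrightarrow> 1 * check_energy r z"
        by (intro tendsto_mult tendsto_const tendsto_chain_length_ratio)
      ultimately have "\<forall>\<^sub>F L in sequentially. real (L + w) / real L * check_energy r z < \<eta> / real l * p"
        by (intro order_tendstoD) auto
      then have "\<forall>\<^sub>F L in sequentially. bp_threshold l r L w \<le> \<eta>"
        using eventually_gt_at_top[of 0]
      proof eventually_elim
        case (elim L)
        show ?case
        proof (rule bp_threshold_le, rule ccontr)
          fix \<epsilon> :: real
          assume \<epsilon>: "0 \<le> \<epsilon>" "\<epsilon> \<le> 1"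
            and lim: "\<forall>t\<in>{1..int L}. (\<lambda>i. chain_evolution {1..int L} l r w \<epsilon> i t) \<longlonglongrightarrow> 0"
            and "\<not> \<epsilon> \<le> \<eta>"
          have "real (L + w) * check_energy r z < real L * (\<eta> / real l * p)"
            using elim by (simp add: field_simps)
          also have "\<dots> \<le> real L * (\<epsilon> / real l * p)"
            using \<open>\<not> \<epsilon> \<le> \<eta>\<close> p by (intro mult_left_mono mult_right_mono divide_right_mono) auto
          finally show False
            using chain_evolution_not_to_zero[of l r \<epsilon> z L w] \<epsilon> lim z l r by (auto simp: p_def)
        qed
      qed
      then obtain L0 where "\<And>L. L0 \<le> L \<Longrightarrow> bp_threshold l r L w \<le> \<eta>"
        by (auto simp: eventually_sequentially)
      then show ?thesis by (intro LIMSEQ_le_const2[OF g]) auto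
    qed
  qed
  have "g \<longlonglongrightarrow> potential_threshold l r"
  proof (rule order_tendstoI)
    fix a assume a: "a < potential_threshold l r"
    show "\<forall>\<^sub>F w in sequentially. a < g w"
    proof (cases "0 \<le> a")
      case True
      obtain \<epsilon> where \<epsilon>: "a < \<epsilon>" "\<epsilon> < potential_threshold l r" using a dense by blast
      with True have \<epsilon>01: "0 \<le> \<epsilon>" "\<epsilon> \<le> 1" using potential_threshold_bounds[OF r, of l] by linarith+
      obtain w0 where w0: "\<And>w t. w0 \<le> w \<Longrightarrow> (\<lambda>i. chain_evolution {1..} l r w \<epsilon> i t) \<longlonglongrightarrow> 0"
        using chain_evolution_half_line_to_zero[OF l r \<epsilon>01(1) \<epsilon>(2)] by blast
      \<comment> \<open>The half-line dominates every finite chain, so one \<open>w0\<close> serves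
        all \<open>L\<close> and the bound survives the limit in \<open>L\<close>.\<close>
      have "\<epsilon> \<le> g w" if "w0 \<le> w" for w
      proof (rule LIMSEQ_le_const[OF g], intro exI allI impI bp_threshold_ge \<epsilon>01)
        fix L t
        show "(\<lambda>i. chain_evolution {1..int L} l r w \<epsilon> i t) \<longlonglongrightarrow> 0"
          by (rule tendsto_sandwich[OF _ _ tendsto_const w0[OF that, of t]])
            (use chain_evolution_bounds[OF \<epsilon>01] chain_evolution_mono[OF \<epsilon>01, of "{1..int L}" "{1..}"] in auto)
      qed
      then have "\<forall>\<^sub>F w in sequentially. \<epsilon> \<le> g w" by (auto simp: eventually_sequentially)
      then show ?thesis by eventually_elim (use \<epsilon>(1) in linarith)
    next
      case False
      then have "a < g w" for w
        using LIMSEQ_le_const[OF g, of 0 w] bp_threshold_bounds(1) by fastforce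
      then show ?thesis by simp
    qed
  qed (use upper le_less_trans in \<open>auto intro!: always_eventually\<close>)
  with g show thesis by (rule that)
qed

section \<open>The potential threshold for large degrees\<close>

text \<open>Take \<open>z = 1\<close>, where the energy is \<open>1/r\<close> and
  \<open>check_map\<close> is 1.\<close>

lemma potential_threshold_le_ratio:
  assumes "2 \<le> r"
  shows "potential_threshold l r \<le> real l / real r"
  using potential_threshold_le[OF assms, of 1 l] assms
  by (simp add: check_energy_def check_map_def power_0_left)

text \<open>Writing \<open>q = sqrt (1 - z) ^ (r - 1)\<close>, both \<open>check_map r z\<close> and the bound on
  \<open>check_energy r z\<close> depend on \<open>q\<close> only, which makes the comparison below uniform in \<open>r\<close>.\<close>

lemma check_energy_lower_bound:
  assumes "0 < r" "0 \<le> z" "z \<le> 1"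
  shows "(1 - sqrt (1 - z) ^ (r - 1))\<^sup>2 \<le> real r * check_energy r z"
    and "check_map r z = 1 - (sqrt (1 - z) ^ (r - 1))\<^sup>2"
proof -
  define b where "b = sqrt (1 - z)"
  obtain m where m: "r = Suc m" using assms(1) gr0_implies_Suc by blast
  have b: "0 \<le> b" "b \<le> 1" and z: "z = 1 - b\<^sup>2" using assms by (simp_all add: b_def)
  have bm: "(1 - z) ^ k = (b ^ k)\<^sup>2" for k by (simp add: z power2_eq_square power_mult_distrib)
  show "check_map r z = 1 - (sqrt (1 - z) ^ (r - 1))\<^sup>2"
    by (simp add: check_map_def bm flip: b_def)
  \<comment> \<open>With \<open>q = b^m\<close> this bounds the cross term, after which
    \<open>r * check_energy r z >= 1 - q^2 - 2*q*(1 - q) = (1 - q)^2\<close>. It follows from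
    \<open>b * (1 + b) <= 2\<close> and the tangent of the \<open>m\<close>-th power at
    \<open>b\<close>, evaluated at 1.\<close>
  have "real m * b ^ m * (1 - b\<^sup>2) \<le> 2 * (1 - b ^ m)"
  proof -
    have "real m * b ^ m * (1 - b\<^sup>2) = (b * (1 + b)) * (real m * b ^ (m - 1) * (1 - b))"
      by (cases m) (auto simp: algebra_simps power2_eq_square)
    also have "\<dots> \<le> 2 * (real m * b ^ (m - 1) * (1 - b))"
      using b mult_mono[of b 1 "1 + b" 2] by (intro mult_right_mono) auto
    also have "\<dots> \<le> 2 * (1 - b ^ m)"
      using power_ge_tangent[of b 1 m] b by simp
    finally show ?thesis .
  qed
  then have "b ^ m * (real m * b ^ m * (1 - b\<^sup>2)) \<le> b ^ m * (2 * (1 - b ^ m))"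
    using b by (intro mult_left_mono) auto
  moreover have "real r * check_energy r z = 1 - (b ^ m)\<^sup>2 - b ^ m * (real m * b ^ m * (1 - b\<^sup>2))"
  proof -
    have "real r * check_energy r z = 1 - (1 - z) ^ r - real r * z * (1 - z) ^ (r - 1)"
      using assms(1) unfolding check_energy_def right_diff_distrib by (simp add: mult.assoc)
    then show ?thesis
      unfolding bm by (simp add: m z algebra_simps power2_eq_square)
  qed
  ultimately show "(1 - sqrt (1 - z) ^ (r - 1))\<^sup>2 \<le> real r * check_energy r z"
    by (simp add: m power2_eq_square algebra_simps flip: b_def)
qed

text \<open>For \<open>q <= \<eta>\<close> the factor \<open>(1 - \<eta>)^2\<close> suffices. For
  \<open>q > \<eta>\<close>, two factors \<open>1 - q^2\<close> supply
  \<open>(1 - q)^2 * (1 + q)^2\<close>, and \<open>k\<close> more factors contribute at most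
  \<open>1/4\<close>, cancelling \<open>(1 + q)^2 <= 4\<close>.\<close>

lemma square_dominates_power:
  fixes \<eta> :: real
  assumes "0 < \<eta>" "\<eta> < 1"
  obtains l0 where "\<And>l q. l0 \<le> l \<Longrightarrow> 0 \<le> q \<Longrightarrow> q \<le> 1 \<Longrightarrow> (1 - \<eta>)\<^sup>2 * (1 - q\<^sup>2) ^ l \<le> (1 - q)\<^sup>2"
proof -
  have \<eta>2: "0 < 1 - \<eta>\<^sup>2" "1 - \<eta>\<^sup>2 < 1" using assms by (simp_all add: power_less_one_iff)
  then obtain k where k: "(1 - \<eta>\<^sup>2) ^ k < 1 / 4"
    using real_arch_pow_inv[of "1 / 4" "1 - \<eta>\<^sup>2"] by auto
  show thesis
  proof (rule that)
    fix l q assume l: "k + 2 \<le> l" and q: "0 \<le> q" "q \<le> (1 :: real)"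
    have q2: "0 \<le> 1 - q\<^sup>2" "1 - q\<^sup>2 \<le> 1" using q by (simp_all add: power_le_one)
    show "(1 - \<eta>)\<^sup>2 * (1 - q\<^sup>2) ^ l \<le> (1 - q)\<^sup>2"
    proof (cases "q \<le> \<eta>")
      case True
      have "(1 - \<eta>)\<^sup>2 * (1 - q\<^sup>2) ^ l \<le> (1 - q)\<^sup>2 * 1"
        using True assms q2 by (intro mult_mono power_mono power_le_one) auto
      then show ?thesis by simp
    next
      case False
      have "1 - q\<^sup>2 \<le> 1 - \<eta>\<^sup>2" using False assms by (simp add: power_mono)
      then have "(1 - q\<^sup>2) ^ k \<le> 1 / 4"
        using k power_mono[of "1 - q\<^sup>2" "1 - \<eta>\<^sup>2" k] q2 by linarith
      have "(1 - \<eta>)\<^sup>2 * (1 - q\<^sup>2) ^ l \<le> 1 * (1 - q\<^sup>2) ^ (k + 2)"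
        using assms q2 l by (intro mult_mono power_le_one power_decreasing) auto
      also have "\<dots> = (1 - q\<^sup>2) ^ k * (1 + q)\<^sup>2 * (1 - q)\<^sup>2"
        by (simp add: power_add power2_eq_square algebra_simps)
      also have "\<dots> \<le> 1 / 4 * 2\<^sup>2 * (1 - q)\<^sup>2"
        using \<open>(1 - q\<^sup>2) ^ k \<le> 1 / 4\<close> q q2 by (intro mult_mono power_mono) auto
      finally show ?thesis by simp
    qed
  qed
qed

text \<open>The upper bound is the ratio at \<open>z = 1\<close>. For the lower bound, the two
  preceding lemmas make every ratio at least \<open>l/r * (1 - \<eta>)^2\<close> once
  \<open>l\<close> is large, uniformly in \<open>z\<close>.\<close>

lemma tendsto_potential_threshold:
  fixes l r :: "nat \<Rightarrow> nat"
  assumes r: "\<And>n. 2 \<le> r n" "filterlim r at_top sequentially"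
    and c: "0 \<le> c" "c \<le> 1" and lim: "(\<lambda>n. real (l n) / real (r n)) \<longlonglongrightarrow> c"
  shows "(\<lambda>n. potential_threshold (l n) (r n)) \<longlonglongrightarrow> c"
proof (rule order_tendstoI)
  fix a assume "c < a"
  with lim have "\<forall>\<^sub>F n in sequentially. real (l n) / real (r n) < a" by (rule order_tendstoD)
  then show "\<forall>\<^sub>F n in sequentially. potential_threshold (l n) (r n) < a"
    by eventually_elim (use potential_threshold_le_ratio[OF r(1)] le_less_trans in blast)
next
  fix a assume a: "a < c"
  show "\<forall>\<^sub>F n in sequentially. a < potential_threshold (l n) (r n)"
  proof (cases "0 \<le> a")
    case False
    then show ?thesis
      using potential_threshold_bounds(1)[OF r(1)] by (intro always_eventually) (meson not_le less_le_trans)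
  next
    case True
    have c0: "0 < c" using True a by simp
    \<comment> \<open>Chosen so that \<open>c * (1 - 2 * \<eta>) = c - 2/3 * (c - a)\<close> still
      exceeds \<open>a\<close>.\<close>
    define \<eta> where "\<eta> = (c - a) / (3 * c)"
    have \<eta>: "0 < \<eta>" "\<eta> < 1" using a True c0 by (simp_all add: \<eta>_def field_simps)
    have "a < c * (1 - 2 * \<eta>)" using a c0 by (simp add: \<eta>_def field_simps)
    also have "\<dots> \<le> c * (1 - \<eta>)\<^sup>2" using c0 by (intro mult_left_mono) (simp_all add: power2_diff)
    finally have a\<eta>: "a < c * (1 - \<eta>)\<^sup>2" .
    obtain l0 where l0: "\<And>l q. l0 \<le> l \<Longrightarrow> 0 \<le> q \<Longrightarrow> q \<le> 1 \<Longrightarrow> (1 - \<eta>)\<^sup>2 * (1 - q\<^sup>2) ^ l \<le> (1 - q)\<^sup>2"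
      using square_dominates_power[OF \<eta>] by blast
    \<comment> \<open>Since \<open>c > 0\<close>, the degrees \<open>l n\<close> tend to infinity
      along with \<open>r n\<close>, so they eventually pass \<open>l0\<close>.\<close>
    have "filterlim (\<lambda>n. real (l n) / real (r n) * real (r n)) at_top sequentially"
      using lim c0 filterlim_compose[OF filterlim_real_sequentially r(2)]
      by (rule filterlim_tendsto_pos_mult_at_top)
    then have "\<forall>\<^sub>F n in sequentially. real l0 \<le> real (l n) / real (r n) * real (r n)"
      by (simp add: filterlim_at_top)
    moreover have "(\<lambda>n. real (l n) / real (r n) * (1 - \<eta>)\<^sup>2) \<longlonglongrightarrow> c * (1 - \<eta>)\<^sup>2"
      by (intro tendsto_intros lim)
    then have "\<forall>\<^sub>F n in sequentially. a < real (l n) / real (r n) * (1 - \<eta>)\<^sup>2"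
      using a\<eta> by (rule order_tendstoD)
    ultimately show ?thesis
    proof eventually_elim
      case (elim n)
      define \<beta> where "\<beta> = real (l n) / real (r n) * (1 - \<eta>)\<^sup>2"
      have ln: "l0 \<le> l n" using elim(1) r(1)[of n] by simp
      have "\<beta> \<le> real (l n) * check_energy (r n) z / check_map (r n) z ^ l n" if z: "0 < z" "z \<le> 1" for z
      proof -
        define q where "q = sqrt (1 - z) ^ (r n - 1)"
        have q: "0 \<le> q" "q \<le> 1" using z by (auto simp: q_def intro!: power_le_one)
        have "(1 - \<eta>)\<^sup>2 * check_map (r n) z ^ l n \<le> real (r n) * check_energy (r n) z"
          using l0[OF ln q] check_energy_lower_bound[of "r n" z] r(1)[of n] z by (simp add: q_def)
        then have "real (l n) / real (r n) * ((1 - \<eta>)\<^sup>2 * check_map (r n) z ^ l n)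
            \<le> real (l n) / real (r n) * (real (r n) * check_energy (r n) z)"
          by (rule mult_left_mono) simp
        then show ?thesis
          using check_map_pos[OF r(1) z, of n] r(1)[of n]
          by (simp add: \<beta>_def pos_le_divide_eq mult.assoc)
      qed
      then have "min 1 \<beta> \<le> potential_threshold (l n) (r n)"
        unfolding potential_threshold_def
        by (intro cInf_greatest) (auto simp: min.coboundedI2)
      moreover have "a < min 1 \<beta>" using elim(2) a c by (simp add: \<beta>_def)
      ultimately show ?case by linarith
    qed
  qed
qed

section \<open>Iterated limits and the relay rate\<close>

lemma iterated_lim_bp_threshold:
  assumes "\<And>n. 2 \<le> r n" "filterlim r at_top sequentially" "\<And>n. 3 \<le> l n"
    and "0 \<le> c" "c \<le> 1" "(\<lambda>n. real (l n) / real (r n)) \<longlonglongrightarrow> c"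
  shows "iterated_lim (\<lambda>n w L. bp_threshold (l n) (r n) L w) c"
proof -
  have "\<forall>n. \<exists>g. (\<forall>w. (\<lambda>L. bp_threshold (l n) (r n) L w) \<longlonglongrightarrow> g w) \<and>
      g \<longlonglongrightarrow> potential_threshold (l n) (r n)"
    using threshold_saturation assms(1,3) by metis
  then obtain g where "\<And>n w. (\<lambda>L. bp_threshold (l n) (r n) L w) \<longlonglongrightarrow> g n w"
      "\<And>n. g n \<longlonglongrightarrow> potential_threshold (l n) (r n)"
    by metis
  moreover have "(\<lambda>n. potential_threshold (l n) (r n)) \<longlonglongrightarrow> c"
    using assms by (intro tendsto_potential_threshold)
  ultimately show ?thesis
    unfolding iterated_lim_def by (intro exI[of _ g] exI[of _ "\<lambda>n. potential_threshold (l n) (r n)"]) simp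
qed

lemma tendsto_design_rate: "(\<lambda>L. design_rate l r L w) \<longlonglongrightarrow> 1 - real l / real r"
proof -
  have "(\<lambda>L. design_rate l r L w) \<longlonglongrightarrow> 1 - real l / real r * 1"
    unfolding design_rate_def by (intro tendsto_diff tendsto_mult tendsto_const tendsto_chain_length_ratio)
  then show ?thesis by simp
qed

lemma iterated_lim_design_rate:
  assumes "(\<lambda>n. real (l n) / real (r n)) \<longlonglongrightarrow> c"
  shows "iterated_lim (\<lambda>n w L. design_rate (l n) (r n) L w) (1 - c)"
proof -
  have "(\<lambda>n. 1 - real (l n) / real (r n)) \<longlonglongrightarrow> 1 - c" by (intro tendsto_intros assms)
  then show ?thesis
    unfolding iterated_lim_def
    by (intro exI[of _ "\<lambda>n w. 1 - real (l n) / real (r n)"] exI[of _ "\<lambda>n. 1 - real (l n) / real (r n)"])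
      (simp add: tendsto_design_rate)
qed

text \<open>The first term of the minimum is nondecreasing in \<open>\<alpha>\<close> and, because
  \<open>C_SD <= C_RD\<close>, the second is nonincreasing. The maximum is thus at their crossing
  \<open>\<beta>\<close>, which is also the share \<open>N1 / (N1 + N2)\<close> of the scheme's
  first phase.\<close>

lemma decode_forward_rate_eq:
  assumes "0 \<le> C_SR" "C_SD < C_SR" "0 < C_RD" "C_SD \<le> C_RD"
  shows "decode_forward_rate C_SR C_SD C_RD = C_SR / (1 + (C_SR - C_SD) / C_RD)"
proof -
  define \<beta> where "\<beta> = 1 / (1 + (C_SR - C_SD) / C_RD)"
  have "0 \<le> (C_SR - C_SD) / C_RD" using assms by simp
  then have \<beta>: "\<beta> \<in> {0..1}" by (simp add: \<beta>_def field_simps)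
  have "C_RD + (C_SR - C_SD) \<noteq> 0" using assms by simp
  then have "\<beta> * (C_RD + (C_SR - C_SD)) = C_RD"
    using assms by (simp add: \<beta>_def field_simps)
  then have eq: "\<beta> * C_SR = \<beta> * C_SD + (1 - \<beta>) * C_RD" by (simp add: algebra_simps)
  have "decode_forward_rate C_SR C_SD C_RD = \<beta> * C_SR"
    unfolding decode_forward_rate_def
  proof (rule cSup_eq_maximum)
    show "\<beta> * C_SR \<in> (\<lambda>\<alpha>. min (\<alpha> * C_SR) (\<alpha> * C_SD + (1 - \<alpha>) * C_RD)) ` {0..1}"
      using \<beta> eq by (intro image_eqI[of _ _ \<beta>]) auto
  next
    fix y assume "y \<in> (\<lambda>\<alpha>. min (\<alpha> * C_SR) (\<alpha> * C_SD + (1 - \<alpha>) * C_RD)) ` {0..1}"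
    then obtain \<alpha> where y: "y = min (\<alpha> * C_SR) (\<alpha> * C_SD + (1 - \<alpha>) * C_RD)" by blast
    show "y \<le> \<beta> * C_SR"
    proof (cases "\<alpha> \<le> \<beta>")
      case True
      then show ?thesis using assms(1) y by (simp add: min.coboundedI1 mult_right_mono)
    next
      case False
      then have "\<beta> * (C_RD - C_SD) \<le> \<alpha> * (C_RD - C_SD)" using assms(4) by (intro mult_right_mono) auto
      then have "\<alpha> * C_SD + (1 - \<alpha>) * C_RD \<le> \<beta> * C_SR" unfolding eq by (simp add: algebra_simps)
      then show ?thesis unfolding y by (rule min.coboundedI2)
    qed
  qed
  then show ?thesis by (simp add: \<beta>_def)
qed

lemma iterated_lim_relay_scheme_rate:
  assumes "(\<lambda>n. real (l n) / real (r n)) \<longlonglongrightarrow> c" "0 < M"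
  shows "iterated_lim (\<lambda>n w L. relay_scheme_rate C_SR C_SD C_RD M (l n) (r n) L w)
    ((1 - c) / (1 + (C_SR - C_SD) / C_RD))"
proof -
  define K where "K = 1 + (C_SR - C_SD) / C_RD"
  have "(\<lambda>L. relay_scheme_rate C_SR C_SD C_RD M (l n) (r n) L w) \<longlonglongrightarrow> (1 - real (l n) / real (r n)) * inverse K"
    for n w
  proof (rule Lim_transform_eventually)
    show "(\<lambda>L. design_rate (l n) (r n) L w * inverse K) \<longlonglongrightarrow> (1 - real (l n) / real (r n)) * inverse K"
      by (intro tendsto_intros tendsto_design_rate)
    \<comment> \<open>Only eventually: at \<open>L = 0\<close> the block length is 0 and cannot be
      cancelled.\<close>
    show "\<forall>\<^sub>F L in sequentially. design_rate (l n) (r n) L w * inverse K =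
        relay_scheme_rate C_SR C_SD C_RD M (l n) (r n) L w"
      using eventually_gt_at_top[of 0]
    proof eventually_elim
      case (elim L)
      define N where "N = real (M * L)"
      have "N \<noteq> 0" using elim assms(2) by (simp add: N_def)
      moreover have "N + N * (C_SR - C_SD) / C_RD = N * K" by (simp add: K_def algebra_simps)
      ultimately show ?case
        unfolding relay_scheme_rate_def Let_def N_def[symmetric] by (simp add: divide_inverse)
    qed
  qed
  moreover have "(\<lambda>n. (1 - real (l n) / real (r n)) * inverse K) \<longlonglongrightarrow> (1 - c) * inverse K"
    by (intro tendsto_intros assms(1))
  ultimately have "iterated_lim (\<lambda>n w L. relay_scheme_rate C_SR C_SD C_RD M (l n) (r n) L w) ((1 - c) * inverse K)"
    unfolding iterated_lim_def
    by (intro exI[of _ "\<lambda>n w. (1 - real (l n) / real (r n)) * inverse K"]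
        exI[of _ "\<lambda>n. (1 - real (l n) / real (r n)) * inverse K"]) simp
  then show ?thesis by (simp add: K_def divide_inverse)
qed

section \<open>Choice of the degrees and conclusion\<close>

lemma tendsto_floor_ratio:
  assumes "0 \<le> c"
  shows "(\<lambda>n. real (k + nat \<lfloor>c * real (n + 2)\<rfloor>) / real (n + 2)) \<longlonglongrightarrow> c"
proof (rule tendsto_sandwich)
  have inv: "(\<lambda>n. a / real (n + 2)) \<longlonglongrightarrow> 0" for a
    using LIMSEQ_ignore_initial_segment[OF lim_const_over_n, of a 2] by simp
  show "(\<lambda>n. c - 1 / real (n + 2)) \<longlonglongrightarrow> c" 
    using tendsto_diff[OF tendsto_const inv] by simp
  show "(\<lambda>n. c + real k / real (n + 2)) \<longlonglongrightarrow> c" 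
    using tendsto_add[OF tendsto_const inv] by simp
  have fl: "c * real (n + 2) - 1 \<le> real (nat \<lfloor>c * real (n + 2)\<rfloor>)"
    "real (nat \<lfloor>c * real (n + 2)\<rfloor>) \<le> c * real (n + 2)" for n
  proof -
    have "0 \<le> c * real (n + 2)" using assms by simp
    then show "c * real (n + 2) - 1 \<le> real (nat \<lfloor>c * real (n + 2)\<rfloor>)"
      "real (nat \<lfloor>c * real (n + 2)\<rfloor>) \<le> c * real (n + 2)" by linarith+
  qed
  show "\<forall>\<^sub>F n in sequentially. c - 1 / real (n + 2) \<le> real (k + nat \<lfloor>c * real (n + 2)\<rfloor>) / real (n + 2)"
  proof (intro always_eventually allI)
    fix n
    have "(c * real (n + 2) - 1) / real (n + 2) \<le> real (k + nat \<lfloor>c * real (n + 2)\<rfloor>) / real (n + 2)"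
      using fl(1)[of n] by (intro divide_right_mono) auto
    moreover have "(c * real (n + 2) - 1) / real (n + 2) = c - 1 / real (n + 2)"
      by (simp add: diff_divide_distrib)
    ultimately show "c - 1 / real (n + 2) \<le> real (k + nat \<lfloor>c * real (n + 2)\<rfloor>) / real (n + 2)" by simp
  qed
  show "\<forall>\<^sub>F n in sequentially. real (k + nat \<lfloor>c * real (n + 2)\<rfloor>) / real (n + 2) \<le> c + real k / real (n + 2)"
  proof (intro always_eventually allI)
    fix n
    have "real (k + nat \<lfloor>c * real (n + 2)\<rfloor>) / real (n + 2) \<le> (c * real (n + 2) + real k) / real (n + 2)"
      using fl(2)[of n] by (intro divide_right_mono) auto
    moreover have "(c * real (n + 2) + real k) / real (n + 2) = c + real k / real (n + 2)"
      by (simp add: add_divide_distrib)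
    ultimately show "real (k + nat \<lfloor>c * real (n + 2)\<rfloor>) / real (n + 2) \<le> c + real k / real (n + 2)" by simp
  qed
qed

text \<open>The rate claim carries the condition \<open>C_SD <= C_RD\<close>. If
  \<open>C_SD > C_RD\<close>, both terms of the minimum increase with \<open>\<alpha>\<close> and
  the supremum is \<open>C_SD\<close>, at \<open>\<alpha> = 1\<close>. The scheme's limit
  \<open>\<beta> * C_SD + (1 - \<beta>) * C_RD\<close> with \<open>\<beta> < 1\<close> is then
  strictly smaller.\<close>

theorem theorem3:
  fixes \<epsilon>_SR \<epsilon>_SD \<epsilon>_RD C_SR C_SD C_RD :: real
  assumes "0 \<le> \<epsilon>_SR" "\<epsilon>_SR < \<epsilon>_SD" "\<epsilon>_SD \<le> 1"
    and "0 \<le> \<epsilon>_RD" "\<epsilon>_RD < 1"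
    and "C_SR = 1 - \<epsilon>_SR" "C_SD = 1 - \<epsilon>_SD" "C_RD = 1 - \<epsilon>_RD"
  shows "\<exists>l1 l2 r :: nat \<Rightarrow> nat.
    (\<forall>n. 0 < l1 n \<and> 0 < l2 n \<and> 0 < r n) \<and>
    filterlim r at_top sequentially \<and>
    iterated_lim (\<lambda>n w L. design_rate (l1 n) (r n) L w) (1 - \<epsilon>_SR) \<and>
    iterated_lim (\<lambda>n w L. bp_threshold (l1 n) (r n) L w) \<epsilon>_SR \<and>
    iterated_lim (\<lambda>n w L. bilayer_design_rate (l1 n) (l2 n) (r n) L w) (1 - \<epsilon>_SD) \<and>
    iterated_lim (\<lambda>n w L. bilayer_bp_threshold (l1 n) (l2 n) (r n) L w) \<epsilon>_SD \<and>
    (C_SD \<le> C_RD \<longrightarrow>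
      (\<forall>M>0. iterated_lim
        (\<lambda>n w L. relay_scheme_rate C_SR C_SD C_RD M (l1 n) (r n) L w)
        (decode_forward_rate C_SR C_SD C_RD)))"
proof -
  define r where "r n = n + 2" for n :: nat
  \<comment> \<open>The offset 3 meets the requirement \<open>l >= 3\<close> of threshold saturation
    even when the floor is 0; the offset 1 in \<open>l2\<close> keeps it positive. Neither affects
    the ratios to \<open>r\<close> in the limit.\<close>
  define l1 where "l1 n = 3 + nat \<lfloor>\<epsilon>_SR * real (n + 2)\<rfloor>" for n
  define l2 where "l2 n = 1 + nat \<lfloor>(\<epsilon>_SD - \<epsilon>_SR) * real (n + 2)\<rfloor>" for n
  have r2: "2 \<le> r n" for n by (simp add: r_def)
  have r_top: "filterlim r at_top sequentially"
    unfolding r_def by (rule filterlim_add_const_nat_at_top)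
  have pos: "0 < l1 n" "0 < l2 n" "0 < r n" "3 \<le> l1 n" "3 \<le> l1 n + l2 n" for n
    by (simp_all add: l1_def l2_def r_def)
  have lim1: "(\<lambda>n. real (l1 n) / real (r n)) \<longlonglongrightarrow> \<epsilon>_SR"
    unfolding l1_def r_def by (rule tendsto_floor_ratio) (rule assms(1))
  have "(\<lambda>n. real (l2 n) / real (r n)) \<longlonglongrightarrow> \<epsilon>_SD - \<epsilon>_SR"
    unfolding l2_def r_def by (rule tendsto_floor_ratio) (use assms(2) in simp)
  from tendsto_add[OF lim1 this]
  have lim12: "(\<lambda>n. real (l1 n + l2 n) / real (r n)) \<longlonglongrightarrow> \<epsilon>_SD"
    by (simp add: add_divide_distrib)
  have "iterated_lim (\<lambda>n w L. bp_threshold (l1 n) (r n) L w) \<epsilon>_SR"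
    by (rule iterated_lim_bp_threshold) (use r2 r_top pos lim1 assms in auto)
  moreover have "iterated_lim (\<lambda>n w L. bp_threshold (l1 n + l2 n) (r n) L w) \<epsilon>_SD"
    by (rule iterated_lim_bp_threshold) (use r2 r_top pos lim12 assms in auto)
  then have "iterated_lim (\<lambda>n w L. bilayer_bp_threshold (l1 n) (l2 n) (r n) L w) \<epsilon>_SD"
    using pos by (simp add: bilayer_bp_threshold_eq)
  moreover have "iterated_lim (\<lambda>n w L. bilayer_design_rate (l1 n) (l2 n) (r n) L w) (1 - \<epsilon>_SD)"
    using iterated_lim_design_rate[OF lim12] by (simp add: bilayer_design_rate_def design_rate_def)
  moreover have "iterated_lim (\<lambda>n w L. relay_scheme_rate C_SR C_SD C_RD M (l1 n) (r n) L w)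
      (decode_forward_rate C_SR C_SD C_RD)" if "C_SD \<le> C_RD" "0 < M" for M
    using iterated_lim_relay_scheme_rate[OF lim1 that(2), of C_SR C_SD C_RD]
      decode_forward_rate_eq[of C_SR C_SD C_RD] that(1) assms by simp
  ultimately show ?thesis
    using iterated_lim_design_rate[OF lim1] pos r_top
    by (intro exI[of _ l1] exI[of _ l2] exI[of _ r]) auto
qed

end
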